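(* Let $n\ge2$, $m\ge0$, let $T$ be a standard tableau of shape $[n-1,1]$ with second-row entry $j$, and for integers $k\ge0$ let $Q_T^{k,m}=\int_{x_1}^{x_j}t^k\prod_{i=1}^n(t-x_i)^m\,dt$. Then the images of $Q_T^{0,m},Q_T^{1,m},\dots,Q_T^{n-2,m}$ form a $\mathbb{Q}$-basis of $\gamma_T\big({\bf QI}_m/\langle e_1,\dots,e_n\rangle\big)$.
   Context: $S_n$ acts on ${\bf R}=\mathbb{Q}[x_1,\dots,x_n]$ by $\sigma P(x_1,\dots,x_n)=P(x_{\sigma(1)},\dots,x_{\sigma(n)})$, extended linearly to $\mathbb{Q}S_n$. ${\bf QI}_m$ is the ring of $P\in{\bf R}$ such that $(x_a-x_b)^{2m+1}$ divides $(1-(a,b))P$ for every transposition $(a,b)$. $e_1,\dots,e_n$ are the elementary symmetric polynomials and $\langle e_1,\dots,e_n\rangle$ is the ideal of ${\bf QI}_m$ they generate; it is $S_n$-stable, so $\mathbb{Q}S_n$ acts on the quotient. Tableaux are in French convention (first row at the bottom); a standard tableau of shape $[n-1,1]$ is a bijective filling with $1,\dots,n$ increasing along rows and up columns. For $U\subseteq\{1,\dots,n\}$, $[U]=\sum_{\sigma\in S_U}\sigma$, $[U]'=\sum_{\sigma\in S_U}\mathrm{sgn}(\sigma)\sigma$; $N(T)=\prod_i[C_i]'$, $P(T)=\prod_i[R_i]$ over columns $C_i$ and rows $R_i$ of $T$, and $\gamma_T=\frac{f_\lambda}{n!}N(T)P(T)$ with $f_\lambda=n-1$. *)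

theory Defs
  imports
    "HOL-Library.Poly_Mapping"
    "HOL-Computational_Algebra.Polynomial"
    "HOL-Combinatorics.Permutations"
    "HOL-Algebra.QuotRing"
    "HOL-Algebra.Embedded_Algebras"
begin

section \<open>Polynomials over the rationals and the action of the symmetric group\<close>

text \<open>
  An exponent vector is a finitely supported map from variable indices to naturals, and a
  polynomial is a finitely supported map from exponent vectors to coefficients.  The type
  has variables \<open>x\<^sub>i\<close> for all naturals \<open>i\<close>;
  the ring in \<open>x\<^sub>1, \<dots>, x\<^sub>n\<close> is the set \<open>polys n\<close>.
\<close>

type_synonym qpoly = "(nat \<Rightarrow>\<^sub>0 nat) \<Rightarrow>\<^sub>0 rat"

definition Const :: "rat \<Rightarrow> qpoly" where
  "Const c = Poly_Mapping.single 0 c"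

definition X :: "nat \<Rightarrow> qpoly" where
  "X i = Poly_Mapping.single (Poly_Mapping.single i 1) 1"

definition polys :: "nat \<Rightarrow> qpoly set" where
  "polys n = {P. \<forall>\<alpha>\<in>Poly_Mapping.keys P. Poly_Mapping.keys \<alpha> \<subseteq> {1..n}}"

text \<open>\<open>perm_act \<sigma> P\<close> is \<open>P(x\<^bsub>\<sigma>(1)\<^esub>, \<dots>, x\<^bsub>\<sigma>(n)\<^esub>)\<close>.\<close>

definition perm_act :: "(nat \<Rightarrow> nat) \<Rightarrow> qpoly \<Rightarrow> qpoly" where
  "perm_act \<sigma> P = (\<Sum>\<alpha>\<in>Poly_Mapping.keys P. Const (Poly_Mapping.lookup P \<alpha>) *
     (\<Prod>i\<in>Poly_Mapping.keys \<alpha>. X (\<sigma> i) ^ Poly_Mapping.lookup \<alpha> i))"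

text \<open>
  An element of the group algebra of the symmetric group on \<open>{1..n}\<close> is represented by its
  coefficient function, which vanishes off the permutations of \<open>{1..n}\<close>.  The product of
  permutations is composition, which makes \<open>perm_act\<close> a left action.
\<close>

type_synonym galg = "(nat \<Rightarrow> nat) \<Rightarrow> rat"

definition galg_one :: galg where
  "galg_one \<sigma> = (if \<sigma> = id then 1 else 0)"

definition galg_mult :: "nat \<Rightarrow> galg \<Rightarrow> galg \<Rightarrow> galg" where
  "galg_mult n u v \<rho> =
     (\<Sum>(\<sigma>, \<tau>) | \<sigma> permutes {1..n} \<and> \<tau> permutes {1..n} \<and> \<sigma> \<circ> \<tau> = \<rho>. u \<sigma> * v \<tau>)"

definition galg_act :: "nat \<Rightarrow> galg \<Rightarrow> qpoly \<Rightarrow> qpoly" where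
  "galg_act n u P = (\<Sum>\<sigma> | \<sigma> permutes {1..n}. Const (u \<sigma>) * perm_act \<sigma> P)"

text \<open>\<open>[U]\<close> and \<open>[U]'\<close>:\<close>

definition sym_sum :: "nat set \<Rightarrow> galg" where
  "sym_sum U \<sigma> = (if \<sigma> permutes U then 1 else 0)"

definition alt_sum :: "nat set \<Rightarrow> galg" where
  "alt_sum U \<sigma> = (if \<sigma> permutes U then of_int (sign \<sigma>) else 0)"


section \<open>Tableaux\<close>

text \<open>
  A shape is the list of its row lengths.  The cell \<open>(r, c)\<close> lies in row \<open>r\<close> and column \<open>c\<close>,
  both counted from \<open>0\<close>; row \<open>0\<close> is the bottom row (French convention).  Values of a filling
  outside the cells of the shape are irrelevant.
\<close>

definition cells :: "nat list \<Rightarrow> (nat \<times> nat) set" where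
  "cells \<mu> = {(r, c). r < length \<mu> \<and> c < \<mu> ! r}"

definition standard_tableau :: "nat list \<Rightarrow> (nat \<times> nat \<Rightarrow> nat) \<Rightarrow> bool" where
  "standard_tableau \<mu> T \<longleftrightarrow>
     bij_betw T (cells \<mu>) {1..sum_list \<mu>} \<and>
     (\<forall>r c c'. (r, c) \<in> cells \<mu> \<and> (r, c') \<in> cells \<mu> \<and> c < c' \<longrightarrow> T (r, c) < T (r, c')) \<and>
     (\<forall>r r' c. (r, c) \<in> cells \<mu> \<and> (r', c) \<in> cells \<mu> \<and> r < r' \<longrightarrow> T (r, c) < T (r', c))"

definition tab_row :: "nat list \<Rightarrow> (nat \<times> nat \<Rightarrow> nat) \<Rightarrow> nat \<Rightarrow> nat set" where
  "tab_row \<mu> T r = {T (r, c) | c. (r, c) \<in> cells \<mu>}"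

definition tab_col :: "nat list \<Rightarrow> (nat \<times> nat \<Rightarrow> nat) \<Rightarrow> nat \<Rightarrow> nat set" where
  "tab_col \<mu> T c = {T (r, c) | r. (r, c) \<in> cells \<mu>}"

text \<open>
  The factors of \<open>tab_N\<close> commute with each other because the columns are disjoint, likewise
  those of \<open>tab_P\<close> for the rows, so the order chosen in the products is immaterial.
\<close>

definition tab_N :: "nat \<Rightarrow> nat list \<Rightarrow> (nat \<times> nat \<Rightarrow> nat) \<Rightarrow> galg" where
  "tab_N n \<mu> T = foldr (galg_mult n) (map (\<lambda>c. alt_sum (tab_col \<mu> T c)) [0..<\<mu> ! 0]) galg_one"

definition tab_P :: "nat \<Rightarrow> nat list \<Rightarrow> (nat \<times> nat \<Rightarrow> nat) \<Rightarrow> galg" where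
  "tab_P n \<mu> T = foldr (galg_mult n) (map (\<lambda>r. sym_sum (tab_row \<mu> T r)) [0..<length \<mu>]) galg_one"

text \<open>\<open>\<gamma>\<^sub>T\<close> for \<open>T\<close> of shape \<open>[n - 1, 1]\<close>, where \<open>f\<^sub>\<lambda> = n - 1\<close>:\<close>

definition gamma :: "nat \<Rightarrow> (nat \<times> nat \<Rightarrow> nat) \<Rightarrow> galg" where
  "gamma n T \<sigma> = of_nat (n - 1) / fact n *
     galg_mult n (tab_N n [n - 1, 1] T) (tab_P n [n - 1, 1] T) \<sigma>"


section \<open>Quasi-invariants and their quotient by the elementary symmetric polynomials\<close>

definition quasi_invariants :: "nat \<Rightarrow> nat \<Rightarrow> qpoly set" where
  "quasi_invariants n m = {P \<in> polys n. \<forall>a\<in>{1..n}. \<forall>b\<in>{1..n}. a \<noteq> b \<longrightarrow>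
     (\<exists>H\<in>polys n. P - perm_act (Transposition.transpose a b) P = (X a - X b) ^ (2 * m + 1) * H)}"

definition QI :: "nat \<Rightarrow> nat \<Rightarrow> qpoly ring" where
  "QI n m = \<lparr>carrier = quasi_invariants n m, mult = (*), one = 1, zero = 0, add = (+)\<rparr>"

definition elem_sym :: "nat \<Rightarrow> nat \<Rightarrow> qpoly" where
  "elem_sym n k = (\<Sum>A | A \<subseteq> {1..n} \<and> card A = k. \<Prod>i\<in>A. X i)"

definition esym_ideal :: "nat \<Rightarrow> nat \<Rightarrow> qpoly set" where
  "esym_ideal n m = genideal (QI n m) (elem_sym n ` {1..n})"

definition QI_quot :: "nat \<Rightarrow> nat \<Rightarrow> qpoly set ring" where
  "QI_quot n m = QI n m Quot esym_ideal n m"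

definition QI_class :: "nat \<Rightarrow> nat \<Rightarrow> qpoly \<Rightarrow> qpoly set" where
  "QI_class n m P = esym_ideal n m +>\<^bsub>QI n m\<^esub> P"

text \<open>
  The induced action on cosets.  The class of \<open>u P\<close> does not depend on the representative
  \<open>P\<close> of \<open>C\<close>, so the union is over equal sets.
\<close>

definition quot_act :: "nat \<Rightarrow> nat \<Rightarrow> galg \<Rightarrow> qpoly set \<Rightarrow> qpoly set" where
  "quot_act n m u C = (\<Union>P\<in>C. QI_class n m (galg_act n u P))"

text \<open>
  The scalars, as a subfield of the quotient ring; multiplying the class of \<open>P\<close> by the class
  of a constant \<open>c\<close> gives the class of \<open>c P\<close>, so spans and linear independence over
  this subfield are those of the rational vector space structure.
\<close>

definition scalars :: "nat \<Rightarrow> nat \<Rightarrow> qpoly set set" where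
  "scalars n m = (\<lambda>c. QI_class n m (Const c)) ` UNIV"

text \<open>
  A list is a basis of \<open>V\<close> over \<open>K\<close>.  A list with a repeated entry is not independent, so
  this is a statement about the indexed family.
\<close>

definition is_basis :: "('a, 'b) ring_scheme \<Rightarrow> 'a set \<Rightarrow> 'a list \<Rightarrow> 'a set \<Rightarrow> bool" where
  "is_basis R K vs V \<longleftrightarrow> ring.independent R K vs \<and> ring.Span R K vs = V"


section \<open>The integrals\<close>

text \<open>
  The formal integral from \<open>a\<close> to \<open>b\<close> of a polynomial in \<open>t\<close> with coefficients in the
  polynomials in the \<open>x\<^sub>i\<close>.
\<close>

definition poly_integral :: "qpoly \<Rightarrow> qpoly \<Rightarrow> qpoly poly \<Rightarrow> qpoly" where
  "poly_integral a b p = (\<Sum>i\<le>Polynomial.degree p.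
     Const (1 / of_nat (i + 1)) * Polynomial.coeff p i * (b ^ (i + 1) - a ^ (i + 1)))"

text \<open>\<open>Q_int n j k m\<close> depends on the tableau only through its second-row entry \<open>j\<close>.\<close>

definition Q_int :: "nat \<Rightarrow> nat \<Rightarrow> nat \<Rightarrow> nat \<Rightarrow> qpoly" where
  "Q_int n j k m = poly_integral (X 1) (X j) ([:0, 1:] ^ k * (\<Prod>i\<in>{1..n}. [:- X i, 1:] ^ m))"

end

theory Submission
  imports Defs
begin

text \<open>
  Let \<open>p(t) = \<Prod>(t - x\<^sub>i)\<close> and let \<open>\<Lambda>\<close> be the ring of symmetric polynomials.  Up to a scalar, \<open>\<gamma>\<^sub>T\<close>
  symmetrizes \<open>P\<close> over the variables other than \<open>x\<^sub>j\<close>, giving \<open>f\<close>, and then forms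
  \<open>f - (1, j) f\<close>.  The key fact is that \<open>\<gamma>\<^sub>T\<close> maps the \<open>m\<close>-quasi-invariants onto the free
  \<open>\<Lambda>\<close>-module with basis the \<open>n - 1\<close> integrals; dividing by the ideal generated by the
  elementary symmetric polynomials then replaces \<open>\<Lambda>\<close> by its constants.

  Spanning is by induction on \<open>m\<close>.  For \<open>m = 0\<close>, \<open>f = F(x\<^sub>j)\<close> with \<open>F\<close> in \<open>\<Lambda>[t]\<close> of degree less
  than \<open>n\<close>, so \<open>f - (1, j) f\<close> is the integral of \<open>F'\<close> from \<open>x\<^sub>1\<close> to \<open>x\<^sub>j\<close>.  In the step,
  \<open>f - (1, j) f\<close> is the integral of \<open>C p\<^sup>m\<close>, and the divisibility by \<open>(x\<^sub>1 - x\<^sub>j)\<^bsup>2 m + 3\<^esup>\<close> forces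
  \<open>C = S p + h p'\<close>; integration by parts turns the integrand into \<open>(S - h' / (m + 1)) p\<^bsup>m + 1\<^esup>\<close>.

  Independence over \<open>\<Lambda>\<close>: if the integral of \<open>C p\<^sup>m\<close> vanishes with \<open>deg C \<le> n - 2\<close>, an
  antiderivative takes the same value at all \<open>x\<^sub>i\<close>, so up to a constant it is divisible by
  \<open>p\<^bsup>m + 1\<^esup>\<close>, which exceeds its degree.
\<close>

hide_const (open) UnivPoly.coeff UnivPoly.monom Poly_Mapping.degree
  up_ring.coeff up_ring.monom

declare One_nat_def [simp del]

section \<open>Constants and variables\<close>

lemma Const_0 [simp]: "Const 0 = 0"
  by (simp add: Const_def)

lemma Const_1 [simp]: "Const 1 = 1"
  by (simp add: Const_def)

lemma Const_add: "Const (c + d) = Const c + Const d"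
  by (simp add: Const_def single_add)

lemma Const_mult: "Const (c * d) = Const c * Const d"
  by (simp add: Const_def mult_single)

lemma Const_minus: "Const (- c) = - Const c"
  by (simp add: Const_def single_uminus)

lemma Const_of_nat: "Const (of_nat k) = of_nat k"
  by (induction k) (simp_all add: Const_add)

lemma Const_eq_0_iff [simp]: "Const c = 0 \<longleftrightarrow> c = 0"
  by (metis Const_def single_zero lookup_single_eq lookup_zero)

lemma Const_neg_1: "Const (- 1) = - 1"
  by (simp add: Const_minus)

lemma X_inject [simp]: "X i = X k \<longleftrightarrow> i = k"
proof
  assume "X i = X k"
  then have "Poly_Mapping.single i (1::nat) = Poly_Mapping.single k 1"
    by (metis X_def lookup_single_eq lookup_single_not_eq zero_neq_one)
  then show "i = k"
    by (metis lookup_single_eq lookup_single_not_eq zero_neq_one)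
qed simp

section \<open>Subalgebras and substitution\<close>

text \<open>Used for the polynomials in a given set of variables and for rings generated by power
  sums; rule induction on membership replaces work with exponent vectors.\<close>

inductive_set subalg :: "qpoly set \<Rightarrow> qpoly set" for G where
  Const: "Const c \<in> subalg G"
| gen: "g \<in> G \<Longrightarrow> g \<in> subalg G"
| add: "p \<in> subalg G \<Longrightarrow> q \<in> subalg G \<Longrightarrow> p + q \<in> subalg G"
| mult: "p \<in> subalg G \<Longrightarrow> q \<in> subalg G \<Longrightarrow> p * q \<in> subalg G"

lemma subalg_0 [simp]: "0 \<in> subalg G"
  using subalg.Const[of 0] by simp

lemma subalg_1 [simp]: "1 \<in> subalg G"
  using subalg.Const[of 1] by simp

lemma subalg_uminus: "p \<in> subalg G \<Longrightarrow> - p \<in> subalg G"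
  using subalg.mult[OF subalg.Const[of "-1"]] by (simp add: Const_neg_1)

lemma subalg_diff: "p \<in> subalg G \<Longrightarrow> q \<in> subalg G \<Longrightarrow> p - q \<in> subalg G"
  using subalg.add[OF _ subalg_uminus] by (simp only: diff_conv_add_uminus)

lemma subalg_power: "p \<in> subalg G \<Longrightarrow> p ^ k \<in> subalg G"
  by (induction k) (auto intro: subalg.mult)

lemma subalg_sum: "(\<And>i. i \<in> S \<Longrightarrow> f i \<in> subalg G) \<Longrightarrow> sum f S \<in> subalg G"
  by (induction S rule: infinite_finite_induct) (auto intro: subalg.add)

lemma subalg_prod: "(\<And>i. i \<in> S \<Longrightarrow> f i \<in> subalg G) \<Longrightarrow> prod f S \<in> subalg G"
  by (induction S rule: infinite_finite_induct) (auto intro: subalg.mult)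

lemmas subalg_intros = subalg.Const subalg.add subalg.mult subalg_0 subalg_1
  subalg_uminus subalg_diff subalg_power subalg_sum subalg_prod subalg.gen

definition mono_eval :: "(nat \<Rightarrow> qpoly) \<Rightarrow> (nat \<Rightarrow>\<^sub>0 nat) \<Rightarrow> qpoly" where
  "mono_eval f \<alpha> = (\<Prod>i\<in>Poly_Mapping.keys \<alpha>. f i ^ Poly_Mapping.lookup \<alpha> i)"

text \<open>The evaluation homomorphism at \<open>f\<close>. The action of a permutation, the
  identification of two variables and the evaluation at 0 are all instances of it.\<close>

definition subst :: "(nat \<Rightarrow> qpoly) \<Rightarrow> qpoly \<Rightarrow> qpoly" where
  "subst f P = (\<Sum>\<alpha>\<in>Poly_Mapping.keys P. Const (Poly_Mapping.lookup P \<alpha>) * mono_eval f \<alpha>)"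

lemma mono_eval_superset:
  assumes "finite S" "Poly_Mapping.keys \<alpha> \<subseteq> S"
  shows "mono_eval f \<alpha> = (\<Prod>i\<in>S. f i ^ Poly_Mapping.lookup \<alpha> i)"
  unfolding mono_eval_def
  by (rule prod.mono_neutral_left) (use assms in \<open>auto simp: in_keys_iff\<close>)

lemma mono_eval_add: "mono_eval f (\<alpha> + \<beta>) = mono_eval f \<alpha> * mono_eval f \<beta>"
proof -
  let ?S = "Poly_Mapping.keys \<alpha> \<union> Poly_Mapping.keys \<beta>"
  have "mono_eval f (\<alpha> + \<beta>) = (\<Prod>i\<in>?S. f i ^ Poly_Mapping.lookup (\<alpha> + \<beta>) i)"
    by (rule mono_eval_superset, rule finite_UnI[OF finite_keys finite_keys], rule keys_add)
  also have "\<dots> = mono_eval f \<alpha> * mono_eval f \<beta>"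
    by (simp add: mono_eval_superset[of ?S] lookup_add power_add prod.distrib)
  finally show ?thesis .
qed

lemma mono_eval_0 [simp]: "mono_eval f 0 = 1"
  by (simp add: mono_eval_def)

lemma subst_superset:
  assumes "finite S" "Poly_Mapping.keys P \<subseteq> S"
  shows "subst f P = (\<Sum>\<alpha>\<in>S. Const (Poly_Mapping.lookup P \<alpha>) * mono_eval f \<alpha>)"
  unfolding subst_def
  by (rule sum.mono_neutral_left) (use assms in \<open>auto simp: in_keys_iff\<close>)

lemma subst_add [simp]: "subst f (P + Q) = subst f P + subst f Q"
proof -
  let ?S = "Poly_Mapping.keys P \<union> Poly_Mapping.keys Q"
  have "subst f (P + Q) = (\<Sum>\<alpha>\<in>?S. Const (Poly_Mapping.lookup (P + Q) \<alpha>) * mono_eval f \<alpha>)"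
    by (rule subst_superset, rule finite_UnI[OF finite_keys finite_keys], rule keys_add)
  also have "\<dots> = subst f P + subst f Q"
    by (simp add: subst_superset[of ?S] lookup_add Const_add sum.distrib distrib_right)
  finally show ?thesis .
qed

lemma subst_0 [simp]: "subst f 0 = 0"
  by (simp add: subst_def)

lemma subst_sum: "subst f (sum g S) = (\<Sum>i\<in>S. subst f (g i))"
  by (induction S rule: infinite_finite_induct) auto

lemma subst_single: "subst f (Poly_Mapping.single \<alpha> c) = Const c * mono_eval f \<alpha>"
  by (subst subst_superset[of "{\<alpha>}"]) auto

lemma sum_single_lookup:
  "(\<Sum>k\<in>Poly_Mapping.keys p. Poly_Mapping.single k (Poly_Mapping.lookup p k)) = p"
proof (rule poly_mapping_eqI)
  fix k
  have "(\<Sum>i\<in>Poly_Mapping.keys p. Poly_Mapping.lookup (Poly_Mapping.single i (Poly_Mapping.lookup p i)) k)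
      = (\<Sum>i\<in>Poly_Mapping.keys p. if i = k then Poly_Mapping.lookup p i else 0)"
    by (rule sum.cong) (auto simp: lookup_single when_def)
  also have "\<dots> = Poly_Mapping.lookup p k"
    by (simp add: in_keys_iff)
  finally show "Poly_Mapping.lookup (\<Sum>k\<in>Poly_Mapping.keys p.
      Poly_Mapping.single k (Poly_Mapping.lookup p k)) k = Poly_Mapping.lookup p k"
    by (simp add: lookup_sum)
qed

lemma subst_mult [simp]: "subst f (P * Q) = subst f P * subst f Q"
proof -
  let ?p = "Poly_Mapping.lookup P" and ?q = "Poly_Mapping.lookup Q"
  have "P * Q = (\<Sum>\<alpha>\<in>Poly_Mapping.keys P. Poly_Mapping.single \<alpha> (?p \<alpha>)) *
      (\<Sum>\<beta>\<in>Poly_Mapping.keys Q. Poly_Mapping.single \<beta> (?q \<beta>))"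
    by (simp add: sum_single_lookup)
  also have "\<dots> = (\<Sum>\<alpha>\<in>Poly_Mapping.keys P. \<Sum>\<beta>\<in>Poly_Mapping.keys Q.
      Poly_Mapping.single (\<alpha> + \<beta>) (?p \<alpha> * ?q \<beta>))"
    by (simp add: sum_product mult_single)
  finally have "subst f (P * Q) = (\<Sum>\<alpha>\<in>Poly_Mapping.keys P. \<Sum>\<beta>\<in>Poly_Mapping.keys Q.
      (Const (?p \<alpha>) * mono_eval f \<alpha>) * (Const (?q \<beta>) * mono_eval f \<beta>))"
    by (simp add: subst_sum subst_single mono_eval_add Const_mult algebra_simps)
  then show ?thesis
    by (simp add: subst_def sum_product)
qed

lemma subst_Const [simp]: "subst f (Const c) = Const c"
  unfolding Const_def by (simp add: subst_single Const_def)

lemma subst_X [simp]: "subst f (X i) = f i"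
  unfolding X_def by (simp add: subst_single mono_eval_def)

lemma subst_1 [simp]: "subst f 1 = 1"
  using subst_Const[of f 1] by (simp del: subst_Const)

lemma subst_uminus [simp]: "subst f (- P) = - subst f P"
  by (metis subst_0 subst_add add.left_inverse add_eq_0_iff)

lemma subst_diff [simp]: "subst f (P - Q) = subst f P - subst f Q"
  using subst_add[of f P "- Q"] by (simp del: subst_add)

lemma subst_power [simp]: "subst f (P ^ k) = subst f P ^ k"
  by (induction k) auto

lemma subst_prod: "subst f (prod g S) = (\<Prod>i\<in>S. subst f (g i))"
  by (induction S rule: infinite_finite_induct) auto

lemma subst_cong:
  assumes "p \<in> subalg (X ` V)" "\<And>i. i \<in> V \<Longrightarrow> f i = g i"
  shows "subst f p = subst g p"
  using assms by (induction) auto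

lemma mono_eval_in_subalg:
  "(\<And>i. i \<in> Poly_Mapping.keys \<alpha> \<Longrightarrow> f i \<in> subalg G) \<Longrightarrow> mono_eval f \<alpha> \<in> subalg G"
  unfolding mono_eval_def by (intro subalg_prod subalg_power) blast

lemma single_eq_mono_eval: "Poly_Mapping.single \<alpha> c = Const c * mono_eval X \<alpha>"
proof -
  have pow: "X i ^ k = Poly_Mapping.single (Poly_Mapping.single i k) 1" for i k
    by (induction k) (auto simp: One_nat_def X_def mult_single single_add[symmetric])
  have prod: "(\<Prod>i\<in>S. Poly_Mapping.single (g i) 1) = Poly_Mapping.single (sum g S) (1::rat)"
    for S and g :: "nat \<Rightarrow> nat \<Rightarrow>\<^sub>0 nat"
    by (induction S rule: infinite_finite_induct) (auto simp: mult_single)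
  have "mono_eval X \<alpha> = Poly_Mapping.single \<alpha> 1"
    unfolding mono_eval_def pow prod sum_single_lookup ..
  then show ?thesis
    by (simp add: Const_def mult_single)
qed

lemma subst_id [simp]: "subst X p = p"
  by (subst (2) sum_single_lookup[symmetric]) (simp add: subst_def single_eq_mono_eval)

lemma in_subalg_if_keys:
  assumes "\<And>\<alpha>. \<alpha> \<in> Poly_Mapping.keys p \<Longrightarrow> Poly_Mapping.keys \<alpha> \<subseteq> V"
  shows "p \<in> subalg (X ` V)"
proof -
  have "subst X p \<in> subalg (X ` V)"
    unfolding subst_def using assms
    by (intro subalg_intros mono_eval_in_subalg) blast+
  then show ?thesis by simp
qed

lemma subalg_X_eq: "subalg (X ` V) = {p. \<forall>\<alpha>\<in>Poly_Mapping.keys p. Poly_Mapping.keys \<alpha> \<subseteq> V}"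
proof
  show "{p. \<forall>\<alpha>\<in>Poly_Mapping.keys p. Poly_Mapping.keys \<alpha> \<subseteq> V} \<subseteq> subalg (X ` V)"
    using in_subalg_if_keys by auto
  show "subalg (X ` V) \<subseteq> {p. \<forall>\<alpha>\<in>Poly_Mapping.keys p. Poly_Mapping.keys \<alpha> \<subseteq> V}"
  proof
    fix p assume "p \<in> subalg (X ` V)"
    then show "p \<in> {p. \<forall>\<alpha>\<in>Poly_Mapping.keys p. Poly_Mapping.keys \<alpha> \<subseteq> V}"
    proof induction
      case (Const c)
      then show ?case by (auto simp: Const_def)
    next
      case (gen g)
      then show ?case by (auto simp: X_def)
    next
      case (add p q)
      then show ?case using keys_add[of p q] by blast
    next
      case (mult p q)
      show ?case
        unfolding mem_Collect_eq
      proof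
        fix \<alpha> assume "\<alpha> \<in> Poly_Mapping.keys (p * q)"
        then obtain a b where "\<alpha> = a + b" "a \<in> Poly_Mapping.keys p" "b \<in> Poly_Mapping.keys q"
          using keys_mult[of p q] by blast
        then show "Poly_Mapping.keys \<alpha> \<subseteq> V"
          using mult.IH keys_add[of a b] by blast
      qed
    qed
  qed
qed

lemma polys_eq_subalg: "polys n = subalg (X ` {1..n})"
  by (simp add: polys_def subalg_X_eq)

lemma qpoly_in_subalg: "p \<in> subalg (range X)"
  by (rule in_subalg_if_keys) auto

lemma qpoly_induct [case_names Const X add mult]:
  assumes "\<And>c. P (Const c)" "\<And>i. P (X i)"
    and "\<And>p q. P p \<Longrightarrow> P q \<Longrightarrow> P (p + q)" "\<And>p q. P p \<Longrightarrow> P q \<Longrightarrow> P (p * q)"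
  shows "P p"
  using qpoly_in_subalg[of p] by induction (use assms in auto)

lemma subst_subst: "subst f (subst g p) = subst (\<lambda>i. subst f (g i)) p"
  by (induction p rule: qpoly_induct) auto

lemma subst_in_subalg:
  assumes "p \<in> subalg (X ` V)" "\<And>i. i \<in> V \<Longrightarrow> f i \<in> subalg G"
  shows "subst f p \<in> subalg G"
  using assms by induction (auto intro: subalg_intros)

text \<open>Setting the variables outside \<open>V\<close> to 0 fixes \<open>d\<close> and
  \<open>d * h\<close>, so the image of \<open>h\<close> is again a quotient of \<open>d * h\<close>
  by \<open>d\<close> and must equal \<open>h\<close>. This keeps the quotients formed later inside
  \<open>polys n\<close>.\<close>

lemma subalg_cancel:
  assumes "d \<in> subalg (X ` V)" "d \<noteq> 0" "d * h \<in> subalg (X ` V)"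
  shows "h \<in> subalg (X ` V)"
proof -
  let ?f = "\<lambda>i. if i \<in> V then X i else 0"
  have fix_V: "subst ?f p = p" if "p \<in> subalg (X ` V)" for p
    using subst_cong[OF that, of ?f X] by simp
  have "d * subst ?f h = d * h"
    using fix_V[OF assms(3)] fix_V[OF assms(1)] by simp
  then have "subst ?f h = h"
    using assms(2) by simp
  moreover have "subst ?f h \<in> subalg (X ` V)"
    by (rule subst_in_subalg[OF qpoly_in_subalg]) (auto intro: subalg_intros)
  ultimately show ?thesis by simp
qed

section \<open>Divisibility by differences of variables\<close>

text \<open>The factor theorem in several variables: replacing \<open>X b\<close> by
  \<open>X a\<close> changes a polynomial by a multiple of \<open>X a - X b\<close>, by induction
  over sums and products.\<close>

lemma X_diff_dvd_iff: "(X a - X b) dvd p \<longleftrightarrow> subst (X(b := X a)) p = 0"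
proof
  assume "(X a - X b) dvd p"
  then show "subst (X(b := X a)) p = 0"
    by (auto elim!: dvdE)
next
  have "(X a - X b) dvd (p - subst (X(b := X a)) p)"
  proof (induction p rule: qpoly_induct)
    case (X i)
    have "(X a - X b) dvd (X b - X a)"
      by (metis dvd_minus_iff dvd_refl minus_diff_eq)
    then show ?case by simp
  next
    case (add p q)
    then show ?case using dvd_add[OF add] by (simp add: algebra_simps)
  next
    case (mult p q)
    have "p * q - subst (X(b := X a)) (p * q) = (p - subst (X(b := X a)) p) * q
        + subst (X(b := X a)) p * (q - subst (X(b := X a)) q)"
      by (simp add: algebra_simps)
    then show ?case using mult by (metis dvd_add dvd_mult dvd_mult2)
  qed simp
  moreover assume "subst (X(b := X a)) p = 0"
  ultimately show "(X a - X b) dvd p" by simp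
qed

text \<open>Identifying \<open>X i\<close> with \<open>X a\<close> does not kill the product already
  split off, since \<open>i\<close> is new and the ring is a domain. So it kills the cofactor, which
  yields the next factor.\<close>

lemma prod_X_diff_dvd:
  assumes "finite S" "a \<notin> S" "\<And>i. i \<in> S \<Longrightarrow> (X a - X i) dvd p"
  shows "(\<Prod>i\<in>S. X a - X i) dvd p"
  using assms
proof (induction S)
  case (insert i S)
  then obtain q where q: "p = (\<Prod>k\<in>S. X a - X k) * q"
    by (auto elim: dvdE)
  have "subst (X(i := X a)) (\<Prod>k\<in>S. X a - X k) = (\<Prod>k\<in>S. X a - X k)"
    unfolding subst_prod using insert by (intro prod.cong) auto
  moreover have "subst (X(i := X a)) p = 0"
    using insert.prems X_diff_dvd_iff by blast
  moreover have "(\<Prod>k\<in>S. X a - X k) \<noteq> 0"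
    using insert by auto
  ultimately have "subst (X(i := X a)) q = 0"
    unfolding q by simp
  then have "(X a - X i) dvd q"
    using X_diff_dvd_iff by blast
  then show ?case
    unfolding q using insert.hyps by (simp add: mult.commute mult_dvd_mono)
qed simp

section \<open>The action of permutations\<close>

lemma perm_act_eq_subst: "perm_act \<sigma> = subst (\<lambda>i. X (\<sigma> i))"
  by (auto simp: fun_eq_iff perm_act_def subst_def mono_eval_def)

lemma perm_act_simps [simp]:
  "perm_act \<sigma> (p + q) = perm_act \<sigma> p + perm_act \<sigma> q"
  "perm_act \<sigma> (p * q) = perm_act \<sigma> p * perm_act \<sigma> q"
  "perm_act \<sigma> (p - q) = perm_act \<sigma> p - perm_act \<sigma> q"
  "perm_act \<sigma> (- p) = - perm_act \<sigma> p"
  "perm_act \<sigma> (p ^ k) = perm_act \<sigma> p ^ k"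
  "perm_act \<sigma> (Const c) = Const c"
  "perm_act \<sigma> 0 = 0"
  "perm_act \<sigma> 1 = 1"
  "perm_act \<sigma> (X i) = X (\<sigma> i)"
  by (simp_all add: perm_act_eq_subst)

lemma perm_act_sum: "perm_act \<sigma> (sum g S) = (\<Sum>i\<in>S. perm_act \<sigma> (g i))"
  by (simp add: perm_act_eq_subst subst_sum)

lemma perm_act_prod: "perm_act \<sigma> (prod g S) = (\<Prod>i\<in>S. perm_act \<sigma> (g i))"
  by (simp add: perm_act_eq_subst subst_prod)

lemma perm_act_comp: "perm_act \<sigma> (perm_act \<tau> p) = perm_act (\<sigma> \<circ> \<tau>) p"
  by (simp add: perm_act_eq_subst subst_subst)

lemma perm_act_id [simp]: "perm_act id p = p"
  by (simp add: perm_act_eq_subst)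

lemma perm_act_in_polys:
  assumes "p \<in> polys n" "\<sigma> permutes {1..n}"
  shows "perm_act \<sigma> p \<in> polys n"
  using assms unfolding polys_eq_subalg perm_act_eq_subst
  by (intro subst_in_subalg) (auto intro!: subalg.gen imageI simp: permutes_in_image simp del: One_nat_def atLeastAtMost_iff)

definition symm_on :: "nat set \<Rightarrow> qpoly \<Rightarrow> bool" where
  "symm_on V p \<longleftrightarrow> (\<forall>\<sigma>. \<sigma> permutes V \<longrightarrow> perm_act \<sigma> p = p)"

lemma symm_onD: "symm_on V p \<Longrightarrow> \<sigma> permutes V \<Longrightarrow> perm_act \<sigma> p = p"
  by (simp add: symm_on_def)

lemma symm_on_intros:
  "symm_on V (Const c)" "symm_on V 0" "symm_on V 1"
  "symm_on V p \<Longrightarrow> symm_on V q \<Longrightarrow> symm_on V (p + q)"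
  "symm_on V p \<Longrightarrow> symm_on V q \<Longrightarrow> symm_on V (p - q)"
  "symm_on V p \<Longrightarrow> symm_on V q \<Longrightarrow> symm_on V (p * q)"
  "symm_on V p \<Longrightarrow> symm_on V (- p)"
  "symm_on V p \<Longrightarrow> symm_on V (p ^ k)"
  by (auto simp: symm_on_def)

lemma symm_on_cancel:
  assumes "symm_on V d" "d \<noteq> 0" "symm_on V (d * h)"
  shows "symm_on V h"
  unfolding symm_on_def
proof (intro allI impI)
  fix \<sigma> assume \<sigma>: "\<sigma> permutes V"
  have "d * perm_act \<sigma> h = d * h"
    using symm_onD[OF assms(3) \<sigma>] symm_onD[OF assms(1) \<sigma>] by simp
  then show "perm_act \<sigma> h = h"
    using assms(2) by simp
qed

definition Lam :: "nat \<Rightarrow> qpoly set" where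
  "Lam n = {p \<in> polys n. symm_on {1..n} p}"

lemma Lam_intros:
  "Const c \<in> Lam n" "0 \<in> Lam n" "1 \<in> Lam n"
  "p \<in> Lam n \<Longrightarrow> q \<in> Lam n \<Longrightarrow> p + q \<in> Lam n"
  "p \<in> Lam n \<Longrightarrow> q \<in> Lam n \<Longrightarrow> p - q \<in> Lam n"
  "p \<in> Lam n \<Longrightarrow> q \<in> Lam n \<Longrightarrow> p * q \<in> Lam n"
  "p \<in> Lam n \<Longrightarrow> - p \<in> Lam n"
  "p \<in> Lam n \<Longrightarrow> p ^ k \<in> Lam n"
  by (auto simp: Lam_def polys_eq_subalg intro: symm_on_intros subalg_intros)

lemma Lam_sum: "(\<And>i. i \<in> S \<Longrightarrow> f i \<in> Lam n) \<Longrightarrow> sum f S \<in> Lam n"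
  by (induction S rule: infinite_finite_induct) (auto intro: Lam_intros)

lemma Lam_fixed: "p \<in> Lam n \<Longrightarrow> \<sigma> permutes {1..n} \<Longrightarrow> perm_act \<sigma> p = p"
  by (simp add: Lam_def symm_on_def)

lemma Lam_polys: "p \<in> Lam n \<Longrightarrow> p \<in> polys n"
  by (simp add: Lam_def)

section \<open>Symmetric polynomials and power sums\<close>

text \<open>Taken over a set of indices because power sums of the variables other than
  \<open>x_j\<close> are needed too. Exponent 0 is allowed and gives the constant
  \<open>card V\<close>.\<close>

definition psum :: "nat set \<Rightarrow> nat \<Rightarrow> qpoly" where
  "psum V k = (\<Sum>i\<in>V. X i ^ k)"

text \<open>Induction on the number of factors. Multiplying the orbit sum for \<open>U\<close> by a
  power sum gives orbit sums over \<open>U\<close> with one exponent raised, plus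
  \<open>card (V - U)\<close> copies of the orbit sum for \<open>insert v U\<close>; that number is
  invertible.\<close>

lemma orbit_sum_in_subalg:
  assumes V: "finite V" and "U \<subseteq> V"
  shows "(\<Sum>\<sigma> | \<sigma> permutes V. \<Prod>u\<in>U. X (\<sigma> u) ^ a u) \<in> subalg (range (psum V))"
proof -
  have "finite U" using assms finite_subset by blast
  then show ?thesis using assms(2)
  proof (induction U arbitrary: a)
    case empty
    have "(\<Sum>\<sigma> | \<sigma> permutes V. 1) = Const (of_nat (card {\<sigma>. \<sigma> permutes V}))"
      by (simp add: Const_of_nat)
    then show ?case using subalg.Const by simp
  next
    case (insert v U)
    let ?P = "{\<sigma>. \<sigma> permutes V}" and ?A = "subalg (range (psum V))"
    define M where "M U a = (\<Sum>\<sigma>\<in>?P. \<Prod>u\<in>U. X (\<sigma> u) ^ a u)" for U and a :: "nat \<Rightarrow> nat"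
    have IH: "M U a \<in> ?A" for a
      using insert unfolding M_def by auto
    \<comment> \<open>A new factor whose index \<open>w\<close> lies in \<open>U\<close> only raises
      the exponent at \<open>w\<close>, so the induction hypothesis applies, with a different
      exponent function.\<close>
    have merged: "(\<Sum>\<sigma>\<in>?P. X (\<sigma> w) ^ a v * (\<Prod>u\<in>U. X (\<sigma> u) ^ a u)) = M U (a(w := a w + a v))"
      if "w \<in> U" for w
      unfolding M_def
    proof (rule sum.cong[OF refl])
      fix \<sigma>
      have "(\<Prod>u\<in>U. X (\<sigma> u) ^ (a(w := a w + a v)) u)
          = X (\<sigma> w) ^ (a w + a v) * (\<Prod>u\<in>U - {w}. X (\<sigma> u) ^ a u)"
        using insert.hyps that by (simp add: prod.remove)
      moreover have "(\<Prod>u\<in>U. X (\<sigma> u) ^ a u) = X (\<sigma> w) ^ a w * (\<Prod>u\<in>U - {w}. X (\<sigma> u) ^ a u)"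
        using insert.hyps that by (simp add: prod.remove)
      ultimately show "X (\<sigma> w) ^ a v * (\<Prod>u\<in>U. X (\<sigma> u) ^ a u)
          = (\<Prod>u\<in>U. X (\<sigma> u) ^ (a(w := a w + a v)) u)"
        by (simp add: power_add)
    qed
    \<comment> \<open>Reindexing by the transposition of \<open>w\<close> and \<open>v\<close> moves
      the new factor to \<open>v\<close>; the factors over \<open>U\<close> stay, as neither index
      lies in \<open>U\<close>.\<close>
    have fresh: "(\<Sum>\<sigma>\<in>?P. X (\<sigma> w) ^ a v * (\<Prod>u\<in>U. X (\<sigma> u) ^ a u)) = M (insert v U) a"
      if "w \<in> V - U" for w
    proof -
      have "Transposition.transpose w v permutes V"
        using that insert.prems by (intro permutes_swap_id) auto
      then have "M (insert v U) a
          = (\<Sum>\<sigma>\<in>?P. \<Prod>u\<in>insert v U. X ((\<sigma> \<circ> Transposition.transpose w v) u) ^ a u)"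
        unfolding M_def by (rule sum_permutations_compose_right)
      also have "\<dots> = (\<Sum>\<sigma>\<in>?P. X (\<sigma> w) ^ a v * (\<Prod>u\<in>U. X (\<sigma> u) ^ a u))"
      proof (rule sum.cong[OF refl])
        fix \<sigma>
        have "(\<Prod>u\<in>U. X ((\<sigma> \<circ> Transposition.transpose w v) u) ^ a u) = (\<Prod>u\<in>U. X (\<sigma> u) ^ a u)"
          by (rule prod.cong) (use that insert.hyps in \<open>auto simp: Transposition.transpose_def\<close>)
        then show "(\<Prod>u\<in>insert v U. X ((\<sigma> \<circ> Transposition.transpose w v) u) ^ a u)
            = X (\<sigma> w) ^ a v * (\<Prod>u\<in>U. X (\<sigma> u) ^ a u)"
          using insert.hyps by simp
      qed
      finally show ?thesis ..
    qed
    have "psum V (a v) * M U a = (\<Sum>\<sigma>\<in>?P. (\<Sum>w\<in>V. X (\<sigma> w) ^ a v) * (\<Prod>u\<in>U. X (\<sigma> u) ^ a u))"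
      unfolding M_def sum_distrib_left
    proof (rule sum.cong[OF refl])
      fix \<sigma> assume "\<sigma> \<in> ?P"
      then have "(\<Sum>w\<in>V. X (\<sigma> w) ^ a v) = psum V (a v)"
        unfolding psum_def using sum.permute[of \<sigma> V "\<lambda>w. X w ^ a v"] by (simp add: comp_def)
      then show "psum V (a v) * (\<Prod>u\<in>U. X (\<sigma> u) ^ a u)
          = (\<Sum>w\<in>V. X (\<sigma> w) ^ a v) * (\<Prod>u\<in>U. X (\<sigma> u) ^ a u)"
        by simp
    qed
    also have "\<dots> = (\<Sum>w\<in>V. \<Sum>\<sigma>\<in>?P. X (\<sigma> w) ^ a v * (\<Prod>u\<in>U. X (\<sigma> u) ^ a u))"
      unfolding sum_distrib_right by (rule sum.swap)
    also have "\<dots> = (\<Sum>w\<in>U. \<Sum>\<sigma>\<in>?P. X (\<sigma> w) ^ a v * (\<Prod>u\<in>U. X (\<sigma> u) ^ a u))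
        + (\<Sum>w\<in>V - U. \<Sum>\<sigma>\<in>?P. X (\<sigma> w) ^ a v * (\<Prod>u\<in>U. X (\<sigma> u) ^ a u))"
      using V insert.prems by (subst sum.subset_diff[of U V]) auto
    also have "\<dots> = (\<Sum>w\<in>U. M U (a(w := a w + a v))) + of_nat (card (V - U)) * M (insert v U) a"
      by (simp add: merged fresh)
    finally have eq: "of_nat (card (V - U)) * M (insert v U) a
        = psum V (a v) * M U a - (\<Sum>w\<in>U. M U (a(w := a w + a v)))"
      by (simp add: algebra_simps)
    have "card (V - U) \<noteq> 0"
      using V insert by auto
    then have inv: "Const (1 / of_nat (card (V - U))) * of_nat (card (V - U)) = 1"
      by (simp flip: Const_of_nat Const_mult)
    then have "M (insert v U) a = Const (1 / of_nat (card (V - U))) *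
        (psum V (a v) * M U a - (\<Sum>w\<in>U. M U (a(w := a w + a v))))"
      unfolding eq[symmetric] mult.assoc[symmetric] inv by simp
    also have "\<dots> \<in> ?A"
      by (intro subalg.mult subalg_diff subalg_sum IH subalg.Const) (auto intro: subalg.gen)
    finally show ?case by (simp add: M_def)
  qed
qed

text \<open>Averaging over the permutations of \<open>V\<close> fixes \<open>p\<close> and turns
  each monomial, up to a scalar, into its part in the variables of \<open>W\<close> times an orbit
  sum over \<open>V\<close>. The cases used later are \<open>W = {j}\<close> and
  \<open>W = {}\<close>.\<close>

lemma symmetric_in_subalg_psum:
  assumes V: "finite V" "V \<inter> W = {}" and p: "p \<in> subalg (X ` (V \<union> W))" "symm_on V p"
  shows "p \<in> subalg (X ` W \<union> range (psum V))"
proof -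
  let ?P = "{\<sigma>. \<sigma> permutes V}" and ?A = "subalg (X ` W \<union> range (psum V))"
  have mono: "subalg (range (psum V)) \<subseteq> ?A"
  proof
    fix q assume "q \<in> subalg (range (psum V))"
    then show "q \<in> ?A" by induction (auto intro: subalg.intros)
  qed
  have orbit: "(\<Sum>\<sigma>\<in>?P. mono_eval (\<lambda>i. X (\<sigma> i)) \<alpha>) \<in> ?A"
    if "Poly_Mapping.keys \<alpha> \<subseteq> V \<union> W" for \<alpha>
  proof -
    let ?K = "Poly_Mapping.keys \<alpha>" and ?a = "Poly_Mapping.lookup \<alpha>"
    have "mono_eval (\<lambda>i. X (\<sigma> i)) \<alpha> = (\<Prod>i\<in>?K - V. X i ^ ?a i) * (\<Prod>i\<in>?K \<inter> V. X (\<sigma> i) ^ ?a i)"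
      if "\<sigma> \<in> ?P" for \<sigma>
    proof -
      have "mono_eval (\<lambda>i. X (\<sigma> i)) \<alpha>
          = (\<Prod>i\<in>?K - V. X (\<sigma> i) ^ ?a i) * (\<Prod>i\<in>?K \<inter> V. X (\<sigma> i) ^ ?a i)"
        unfolding mono_eval_def by (subst prod.union_disjoint[symmetric]) (auto intro!: prod.cong)
      moreover have "(\<Prod>i\<in>?K - V. X (\<sigma> i) ^ ?a i) = (\<Prod>i\<in>?K - V. X i ^ ?a i)"
        using that by (intro prod.cong) (auto simp: permutes_not_in)
      ultimately show ?thesis by simp
    qed
    then have "(\<Sum>\<sigma>\<in>?P. mono_eval (\<lambda>i. X (\<sigma> i)) \<alpha>)
        = (\<Prod>i\<in>?K - V. X i ^ ?a i) * (\<Sum>\<sigma>\<in>?P. \<Prod>i\<in>?K \<inter> V. X (\<sigma> i) ^ ?a i)"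
      by (simp add: sum_distrib_left)
    also have "\<dots> \<in> ?A"
    proof (rule subalg.mult)
      show "(\<Prod>i\<in>?K - V. X i ^ ?a i) \<in> ?A"
        by (intro subalg_prod subalg_power subalg.gen) (use that in auto)
      show "(\<Sum>\<sigma>\<in>?P. \<Prod>i\<in>?K \<inter> V. X (\<sigma> i) ^ ?a i) \<in> ?A"
        using orbit_sum_in_subalg[OF V(1), of "?K \<inter> V" ?a] mono by auto
    qed
    finally show ?thesis .
  qed
  have "(\<Sum>\<sigma>\<in>?P. perm_act \<sigma> p) = (\<Sum>\<alpha>\<in>Poly_Mapping.keys p. Const (Poly_Mapping.lookup p \<alpha>) *
      (\<Sum>\<sigma>\<in>?P. mono_eval (\<lambda>i. X (\<sigma> i)) \<alpha>))"
    unfolding perm_act_eq_subst subst_def sum_distrib_left by (rule sum.swap)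
  also have "\<dots> \<in> ?A"
    by (intro subalg_sum subalg.mult subalg.Const orbit) (use p in \<open>auto simp: subalg_X_eq\<close>)
  finally have in_A: "(\<Sum>\<sigma>\<in>?P. perm_act \<sigma> p) \<in> ?A" .
  have sum_eq: "(\<Sum>\<sigma>\<in>?P. perm_act \<sigma> p) = of_nat (card ?P) * p"
    using p(2) by (simp add: symm_on_def)
  have inv: "Const (1 / of_nat (card ?P)) * of_nat (card ?P) = 1"
    using V by (simp add: card_permutations flip: Const_of_nat Const_mult)
  have "p = Const (1 / of_nat (card ?P)) * (\<Sum>\<sigma>\<in>?P. perm_act \<sigma> p)"
    unfolding sum_eq mult.assoc[symmetric] inv by simp
  then show ?thesis
    using in_A by (metis subalg.Const subalg.mult)
qed

lemma psum_in_Lam: "psum {1..n} k \<in> Lam n"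
proof -
  have "perm_act \<sigma> (psum {1..n} k) = psum {1..n} k" if "\<sigma> permutes {1..n}" for \<sigma>
    unfolding psum_def perm_act_sum
    using sum.permute[OF that, of "\<lambda>w. X w ^ k"] by (simp add: comp_def)
  moreover have "psum {1..n} k \<in> polys n"
    unfolding psum_def polys_eq_subalg by (intro subalg_sum subalg_power subalg.gen) auto
  ultimately show ?thesis
    by (auto simp: Lam_def symm_on_def)
qed

section \<open>Univariate polynomials with symmetric coefficients\<close>

text \<open>The ring \<open>\<Lambda>[t]\<close>, as a subset of \<open>qpoly poly\<close> because
  \<open>\<Lambda>\<close> is a set and not a type.\<close>

definition LamP :: "nat \<Rightarrow> qpoly poly set" where
  "LamP n = {F. \<forall>k. coeff F k \<in> Lam n}"

lemma LamP_pCons: "c \<in> Lam n \<Longrightarrow> F \<in> LamP n \<Longrightarrow> pCons c F \<in> LamP n"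
  by (auto simp: LamP_def coeff_pCons split: nat.split)

lemma LamP_0: "0 \<in> LamP n"
  by (simp add: LamP_def Lam_intros)

lemma LamP_const: "c \<in> Lam n \<Longrightarrow> [:c:] \<in> LamP n"
  by (intro LamP_pCons LamP_0)

lemma LamP_1: "1 \<in> LamP n"
  using LamP_const[of 1 n] by (simp add: Lam_intros one_pCons)

lemma LamP_add: "F \<in> LamP n \<Longrightarrow> G \<in> LamP n \<Longrightarrow> F + G \<in> LamP n"
  by (simp add: LamP_def Lam_intros)

lemma LamP_diff: "F \<in> LamP n \<Longrightarrow> G \<in> LamP n \<Longrightarrow> F - G \<in> LamP n"
  by (simp add: LamP_def Lam_intros)

lemma LamP_smult: "c \<in> Lam n \<Longrightarrow> F \<in> LamP n \<Longrightarrow> Polynomial.smult c F \<in> LamP n"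
  by (simp add: LamP_def Lam_intros)

lemma LamP_mult: "F \<in> LamP n \<Longrightarrow> G \<in> LamP n \<Longrightarrow> F * G \<in> LamP n"
  by (auto simp: LamP_def coeff_mult intro!: Lam_sum Lam_intros)

lemma LamP_power: "F \<in> LamP n \<Longrightarrow> F ^ k \<in> LamP n"
  by (induction k) (auto intro: LamP_1 LamP_mult)

lemma Lam_of_nat: "of_nat k \<in> Lam n"
  by (metis Const_of_nat Lam_intros(1))

lemma LamP_pderiv: "F \<in> LamP n \<Longrightarrow> pderiv F \<in> LamP n"
  by (auto simp: LamP_def coeff_pderiv simp flip: of_nat_Suc intro!: Lam_intros Lam_of_nat)

lemma LamP_monom: "c \<in> Lam n \<Longrightarrow> monom c k \<in> LamP n"
  by (auto simp: LamP_def intro: Lam_intros)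

lemmas LamP_intros = LamP_0 LamP_1 LamP_add LamP_diff LamP_smult LamP_mult LamP_power LamP_pderiv
  LamP_const LamP_monom

text \<open>Symmetric coefficients do not move, so a permutation acts only on the point of
  evaluation. This carries information at \<open>x_j\<close> over to every other
  \<open>x_i\<close>.\<close>

lemma perm_act_poly:
  assumes "F \<in> LamP n" "\<sigma> permutes {1..n}"
  shows "perm_act \<sigma> (poly F x) = poly F (perm_act \<sigma> x)"
  unfolding poly_altdef perm_act_sum
  using assms by (intro sum.cong refl) (simp add: LamP_def Lam_fixed[OF _ assms(2)])

lemma poly_LamP_in_polys:
  assumes "F \<in> LamP n" "i \<in> {1..n}"
  shows "poly F (X i) \<in> polys n"
  unfolding poly_altdef polys_eq_subalg
proof (intro subalg_sum subalg.mult subalg_power)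
  show "coeff F k \<in> subalg (X ` {1..n})" for k
    using assms(1) Lam_polys unfolding LamP_def polys_eq_subalg by blast
  show "X i \<in> subalg (X ` {1..n})"
    using assms(2) by (auto intro: subalg.gen)
qed

text \<open>Such polynomials are generated by \<open>x_j\<close> and the power sums of the other
  variables. The latter are full power sums minus powers of \<open>x_j\<close>, hence values at
  \<open>x_j\<close> of elements of \<open>\<Lambda>[t]\<close>.\<close>

lemma partially_symmetric_eq_poly:
  assumes j: "j \<in> {1..n}" and p: "p \<in> polys n" "symm_on ({1..n} - {j}) p"
  shows "\<exists>F\<in>LamP n. poly F (X j) = p"
proof -
  let ?V = "{1..n} - {j}"
  have "insert j {1..n} = {1..n}" using j by blast
  then have "p \<in> subalg (X ` {j} \<union> range (psum ?V))"
    using p j by (intro symmetric_in_subalg_psum) (auto simp: polys_eq_subalg)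
  then show ?thesis
  proof induction
    case (Const c)
    have "poly [:Const c:] (X j) = Const c" by simp
    then show ?case using LamP_const Lam_intros(1) by metis
  next
    case (gen g)
    then consider "g = X j" | k where "g = psum ?V k" by auto
    then show ?case
    proof cases
      case 1
      have "poly [:0, 1:] (X j) = X j" by simp
      moreover have "[:0, 1:] \<in> LamP n" by (intro LamP_pCons LamP_0) (auto intro: Lam_intros)
      ultimately show ?thesis using 1 by metis
    next
      case 2
      have "psum {1..n} k = X j ^ k + psum ?V k"
        unfolding psum_def using j by (subst sum.remove) auto
      then have "poly ([:psum {1..n} k:] - monom 1 k) (X j) = g"
        by (simp add: poly_monom 2)
      moreover have "[:psum {1..n} k:] - monom 1 k \<in> LamP n"
        by (intro LamP_intros psum_in_Lam Lam_intros)
      ultimately show ?thesis by metis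
    qed
  next
    case (add p q)
    then show ?case by (metis LamP_add poly_add)
  next
    case (mult p q)
    then show ?case by (metis LamP_mult poly_mult)
  qed
qed

section \<open>The polynomial with roots \<open>x\<^sub>1, \<dots>, x\<^sub>n\<close>\<close>

definition rootp :: "nat \<Rightarrow> qpoly poly" where
  "rootp n = (\<Prod>i\<in>{1..n}. [:- X i, 1:])"

lemma degree_prod_linear:
  "degree (\<Prod>i\<in>S. [:- X i, 1:]) = card S" "lead_coeff (\<Prod>i\<in>S. [:- X i, 1:]) = 1"
proof -
  show "degree (\<Prod>i\<in>S. [:- X i, 1:]) = card S"
    by (cases "finite S") (simp_all add: degree_prod_eq_sum_degree)
  show "lead_coeff (\<Prod>i\<in>S. [:- X i, 1:]) = 1"
    by (simp add: lead_coeff_prod)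
qed

lemma degree_rootp [simp]: "degree (rootp n) = n"
  and coeff_rootp_n [simp]: "coeff (rootp n) n = 1"
  using degree_prod_linear[of "{1..n}"] by (simp_all add: rootp_def)

lemma rootp_neq_0 [simp]: "rootp n \<noteq> 0"
  using coeff_rootp_n[of n] by (metis coeff_0 zero_neq_one)

lemma poly_rootp_X: "i \<in> {1..n} \<Longrightarrow> poly (rootp n) (X i) = 0"
  by (auto simp: rootp_def poly_prod)

text \<open>Vieta's formulas: in the expanded product, the set \<open>A\<close> of factors that
  contribute their root gives a term in \<open>t\<close> of exponent
  \<open>n - card A\<close>.\<close>

lemma coeff_rootp:
  assumes "k \<le> n"
  shows "coeff (rootp n) k = (- 1) ^ (n - k) * elem_sym n (n - k)"
proof -
  have "rootp n = (\<Prod>i\<in>{1..n}. [:- X i:] + [:0, 1:])"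
    by (simp add: rootp_def)
  also have "\<dots> = (\<Sum>A\<in>Pow {1..n}. (\<Prod>i\<in>A. [:- X i:]) * (\<Prod>i\<in>{1..n} - A. [:0, 1:]))"
    by (rule prod_add) simp
  also have "\<dots> = (\<Sum>A\<in>Pow {1..n}. monom (\<Prod>i\<in>A. - X i) (n - card A))"
  proof (rule sum.cong[OF refl])
    fix A assume A: "A \<in> Pow {1..n}"
    then have "card ({1..n} - A) = n - card A"
      by (subst card_Diff_subset) (auto intro: finite_subset)
    moreover have "(\<Prod>i\<in>A. [:- X i:]) = [:\<Prod>i\<in>A. - X i:]"
      by (induction A rule: infinite_finite_induct) (auto simp: one_pCons)
    ultimately show "(\<Prod>i\<in>A. [:- X i:]) * (\<Prod>i\<in>{1..n} - A. [:0, 1:])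
        = monom (\<Prod>i\<in>A. - X i) (n - card A)"
      by (simp add: monom_altdef)
  qed
  finally have "coeff (rootp n) k
      = (\<Sum>A\<in>Pow {1..n}. if n - card A = k then (\<Prod>i\<in>A. - X i) else 0)"
    by (simp add: coeff_sum)
  also have "\<dots> = (\<Sum>A\<in>{A \<in> Pow {1..n}. n - card A = k}. \<Prod>i\<in>A. - X i)"
    by (subst sum.inter_filter) auto
  also have "{A \<in> Pow {1..n}. n - card A = k} = {A. A \<subseteq> {1..n} \<and> card A = n - k}"
  proof -
    have "card A \<le> n" if "A \<subseteq> {1..n}" for A
      using card_mono[OF _ that] by simp
    then show ?thesis using assms by fastforce
  qed
  also have "(\<Sum>A\<in>{A. A \<subseteq> {1..n} \<and> card A = n - k}. \<Prod>i\<in>A. - X i)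
      = (- 1) ^ (n - k) * elem_sym n (n - k)"
    by (simp add: elem_sym_def sum_distrib_left prod_uminus)
  finally show ?thesis .
qed

lemma elem_sym_in_Lam: "elem_sym n k \<in> Lam n"
proof -
  have "perm_act \<sigma> (elem_sym n k) = elem_sym n k" if \<sigma>: "\<sigma> permutes {1..n}" for \<sigma>
  proof -
    let ?S = "{A. A \<subseteq> {1..n} \<and> card A = k}"
    have inj: "inj_on \<sigma> A" for A
      using \<sigma> permutes_inj inj_on_subset by blast
    have "perm_act \<sigma> (elem_sym n k) = (\<Sum>A\<in>?S. \<Prod>i\<in>\<sigma> ` A. X i)"
      unfolding elem_sym_def perm_act_sum perm_act_prod
      by (simp add: prod.reindex[OF inj] comp_def)
    also have "\<dots> = (\<Sum>A\<in>?S. \<Prod>i\<in>A. X i)"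
    proof (rule sum.reindex_bij_witness[where j = "\<lambda>A. \<sigma> ` A" and i = "\<lambda>A. inv_into UNIV \<sigma> ` A"])
      fix A assume A: "A \<in> ?S"
      have inj': "inj_on (inv_into UNIV \<sigma>) A"
        using permutes_inv[OF \<sigma>] permutes_inj inj_on_subset by blast
      show "inv_into UNIV \<sigma> ` \<sigma> ` A = A" "\<sigma> ` inv_into UNIV \<sigma> ` A = A"
        using permutes_inverses[OF \<sigma>] by (auto simp: image_image)
      show "\<sigma> ` A \<in> ?S"
        using A permutes_image[OF \<sigma>] card_image[OF inj, of A] by blast
      show "inv_into UNIV \<sigma> ` A \<in> ?S"
        using A permutes_image[OF permutes_inv[OF \<sigma>]] card_image[OF inj'] by blast
    qed auto
    finally show ?thesis by (simp add: elem_sym_def)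
  qed
  moreover have "elem_sym n k \<in> polys n"
    unfolding elem_sym_def polys_eq_subalg by (intro subalg_sum subalg_prod subalg.gen) auto
  ultimately show ?thesis
    by (auto simp: Lam_def symm_on_def)
qed

lemma rootp_in_LamP: "rootp n \<in> LamP n"
proof -
  have "coeff (rootp n) k \<in> Lam n" for k
  proof (cases "k \<le> n")
    case True
    then show ?thesis
      using coeff_rootp[OF True] elem_sym_in_Lam by (auto intro!: Lam_intros)
  next
    case False
    then show ?thesis by (simp add: coeff_eq_0 Lam_intros)
  qed
  then show ?thesis by (simp add: LamP_def)
qed

text \<open>The divisor is monic, so cancelling leading terms needs no division of coefficients and
  quotient and remainder stay in \<open>\<Lambda>[t]\<close>.\<close>

lemma LamP_divide_rootp:
  assumes "F \<in> LamP n" "n > 0"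
  shows "\<exists>S\<in>LamP n. \<exists>R\<in>LamP n. F = S * rootp n + R \<and> degree R < n"
  using assms(1)
proof (induction "degree F" arbitrary: F rule: less_induct)
  case less
  show ?case
  proof (cases "degree F < n")
    case True
    then show ?thesis using less.prems LamP_0 by (metis add_0 mult_zero_left)
  next
    case False
    define d where "d = degree F"
    define G where "G = F - monom (coeff F d) (d - n) * rootp n"
    have c: "coeff F d \<in> Lam n" using less.prems by (simp add: LamP_def)
    have G_in: "G \<in> LamP n"
      unfolding G_def using c less.prems by (intro LamP_intros rootp_in_LamP)
    have F0: "coeff F d \<noteq> 0"
      using False assms(2) unfolding d_def by auto
    have deg: "degree (monom (coeff F d) (d - n) * rootp n) = d"
      using F0 False by (simp add: degree_mult_eq degree_monom_eq d_def)
    have "coeff G d = 0"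
      using False by (simp add: G_def d_def coeff_monom_mult)
    moreover have "degree G \<le> d"
      unfolding G_def using deg degree_diff_le[of F d] by (simp add: d_def)
    ultimately have "degree G < d"
      using False assms(2) unfolding d_def
      by (metis (no_types, lifting) bot_nat_0.not_eq_extremum degree_0 leading_coeff_0_iff le_neq_implies_less not_le less_le_trans)
    then obtain S R where "S \<in> LamP n" "R \<in> LamP n" "G = S * rootp n + R" "degree R < n"
      using less.hyps[of G] G_in d_def by blast
    moreover from this have "F = (S + monom (coeff F d) (d - n)) * rootp n + R"
      by (simp add: G_def algebra_simps)
    ultimately show ?thesis
      using c by (metis LamP_add LamP_monom)
  qed
qed

text \<open>The points \<open>X i\<close> are distinct and the coefficients form a domain, so the
  linear factors can be split off one after the other.\<close>

lemma poly_zero_at_X_dvd: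
  assumes "finite S" "\<And>i. i \<in> S \<Longrightarrow> poly F (X i) = 0"
  shows "(\<Prod>i\<in>S. [:- X i, 1:]) dvd F"
  using assms
proof (induction S)
  case (insert i S)
  then obtain G where G: "F = (\<Prod>k\<in>S. [:- X k, 1:]) * G"
    by (auto elim: dvdE)
  have "poly (\<Prod>k\<in>S. [:- X k, 1:]) (X i) \<noteq> 0"
    using insert by (auto simp: poly_prod)
  then have "poly G (X i) = 0"
    using insert.prems[of i] G by simp
  then have "[:- X i, 1:] dvd G"
    using poly_eq_0_iff_dvd by blast
  then show ?case
    unfolding G prod.insert[OF insert.hyps(1,2)] by (subst mult.commute) (rule mult_dvd_mono, simp_all)
qed simp

lemma rootp_dvd: "(\<And>i. i \<in> {1..n} \<Longrightarrow> poly F (X i) = 0) \<Longrightarrow> rootp n dvd F"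
  unfolding rootp_def by (rule poly_zero_at_X_dvd) auto

section \<open>Symmetric polynomials without constant term\<close>

text \<open>The ideal of \<open>\<Lambda>\<close> generated by the elementary symmetric polynomials.
  Its coefficients are symmetric, whereas \<open>esym_combs\<close> below admits quasi-invariant
  ones.\<close>

definition esym_span :: "nat \<Rightarrow> qpoly set" where
  "esym_span n = {\<Sum>k\<in>{1..n}. elem_sym n k * g k | g. \<forall>k. g k \<in> Lam n}"

lemma esym_spanI:
  "(\<And>k. g k \<in> Lam n) \<Longrightarrow> (\<Sum>k\<in>{1..n}. elem_sym n k * g k) \<in> esym_span n"
  unfolding esym_span_def by blast

lemma esym_span_add: "p \<in> esym_span n \<Longrightarrow> q \<in> esym_span n \<Longrightarrow> p + q \<in> esym_span n"
proof -
  assume "p \<in> esym_span n" "q \<in> esym_span n"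
  then obtain g h where "p = (\<Sum>k\<in>{1..n}. elem_sym n k * g k)" "\<forall>k. g k \<in> Lam n"
    "q = (\<Sum>k\<in>{1..n}. elem_sym n k * h k)" "\<forall>k. h k \<in> Lam n"
    unfolding esym_span_def by blast
  then have "p + q = (\<Sum>k\<in>{1..n}. elem_sym n k * (g k + h k))" "g k + h k \<in> Lam n" for k
    by (auto simp: sum.distrib algebra_simps intro: Lam_intros)
  then show ?thesis by (simp add: esym_spanI)
qed

lemma esym_span_mult: "p \<in> esym_span n \<Longrightarrow> q \<in> Lam n \<Longrightarrow> q * p \<in> esym_span n"
proof -
  assume "p \<in> esym_span n" "q \<in> Lam n"
  moreover from this obtain g where "p = (\<Sum>k\<in>{1..n}. elem_sym n k * g k)" "\<forall>k. g k \<in> Lam n"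
    unfolding esym_span_def by blast
  ultimately have "q * p = (\<Sum>k\<in>{1..n}. elem_sym n k * (q * g k))" "q * g k \<in> Lam n" for k
    by (auto simp: sum_distrib_left algebra_simps intro: Lam_intros)
  then show ?thesis by (simp add: esym_spanI)
qed

lemma esym_span_diff: "p \<in> esym_span n \<Longrightarrow> q \<in> esym_span n \<Longrightarrow> p - q \<in> esym_span n"
  using esym_span_add[of p n "- 1 * q"] esym_span_mult[of q n "- 1"] by (auto intro: Lam_intros)

lemma elem_sym_in_esym_span: "k \<in> {1..n} \<Longrightarrow> elem_sym n k \<in> esym_span n"
proof -
  assume k: "k \<in> {1..n}"
  have "elem_sym n k = (\<Sum>i\<in>{1..n}. elem_sym n i * (if i = k then 1 else 0))"
    using k by (simp add: if_distrib cong: if_cong)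
  moreover have "(if i = k then 1 else 0) \<in> Lam n" for i by (simp add: Lam_intros)
  ultimately show ?thesis by (simp add: esym_spanI)
qed

lemma coeff_rootp_in_esym_span:
  assumes "k < n" shows "coeff (rootp n) k \<in> esym_span n"
proof -
  have "coeff (rootp n) k = (- 1) ^ (n - k) * elem_sym n (n - k)"
    using coeff_rootp assms by simp
  also have "\<dots> \<in> esym_span n"
    using assms by (intro esym_span_mult elem_sym_in_esym_span Lam_intros) auto
  finally show ?thesis .
qed

text \<open>Synthetic division of \<open>rootp n\<close> by \<open>t - x\<^sub>i\<close>, summed over \<open>i\<close> (Newton's identities).\<close>

lemma psum_in_esym_span:
  assumes "l > 0"
  shows "psum {1..n} l \<in> esym_span n"
proof (cases "n = 0")
  case True
  have "0 \<in> esym_span n"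
    using esym_spanI[of "\<lambda>_. 0" n] by (simp add: Lam_intros)
  then show ?thesis using True by (simp add: psum_def)
next
  case False
  define q where "q i = (\<Prod>k\<in>{1..n} - {i}. [:- X k, 1:])" for i
  \<comment> \<open>The sum over \<open>i\<close> of \<open>x_i^l\<close> times the coefficient of
    \<open>t^k\<close> in \<open>p / (t - x_i)\<close>. Comparing coefficients in
    \<open>p = (t - x_i) q_i\<close> lowers \<open>k\<close> and \<open>l\<close> together.\<close>
  define S where "S k l = (\<Sum>i\<in>{1..n}. X i ^ l * coeff (q i) k)" for k l
  have root_q: "rootp n = [:- X i, 1:] * q i" if "i \<in> {1..n}" for i
    unfolding rootp_def q_def using that by (subst prod.remove) auto
  have step: "S (Suc k) (Suc l) = S k l - psum {1..n} l * coeff (rootp n) (Suc k)" for k l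
  proof -
    have *: "coeff (rootp n) (Suc k) = coeff (q i) k - X i * coeff (q i) (Suc k)" if "i \<in> {1..n}" for i
      by (subst root_q[OF that]) simp
    have "X i ^ l * coeff (q i) k
        = X i ^ l * coeff (rootp n) (Suc k) + X i ^ Suc l * coeff (q i) (Suc k)"
      if "i \<in> {1..n}" for i unfolding *[OF that] by (simp add: algebra_simps)
    then have "S k l = (\<Sum>i\<in>{1..n}. X i ^ l * coeff (rootp n) (Suc k)
        + X i ^ Suc l * coeff (q i) (Suc k))"
      unfolding S_def by (intro sum.cong) auto
    then show ?thesis
      by (simp add: S_def psum_def sum.distrib sum_distrib_right)
  qed
  have base: "S 0 (Suc l) = (- psum {1..n} l) * coeff (rootp n) 0" for l
  proof -
    have "coeff (rootp n) 0 = - X i * coeff (q i) 0" if "i \<in> {1..n}" for i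
      by (subst root_q[OF that]) simp
    then have "X i ^ Suc l * coeff (q i) 0 = - (X i ^ l * coeff (rootp n) 0)" if "i \<in> {1..n}" for i
      using that by (simp add: algebra_simps)
    then have "S 0 (Suc l) = (\<Sum>i\<in>{1..n}. - (X i ^ l * coeff (rootp n) 0))"
      unfolding S_def by (intro sum.cong) auto
    then show ?thesis
      by (simp add: psum_def sum_distrib_right sum_negf)
  qed
  \<comment> \<open>By the product rule \<open>p'\<close> is the sum of the \<open>q i\<close>,
    which settles the end \<open>l = 0\<close> of the recursion.\<close>
  have deriv: "S k 0 = of_nat (Suc k) * coeff (rootp n) (Suc k)" for k
  proof -
    have "pderiv (rootp n) = (\<Sum>i\<in>{1..n}. q i)"
      unfolding rootp_def q_def by (simp add: pderiv_prod pderiv_pCons)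
    then have "S k 0 = coeff (pderiv (rootp n)) k"
      by (simp add: S_def coeff_sum)
    then show ?thesis by (simp add: coeff_pderiv)
  qed
  \<comment> \<open>The excluded value \<open>S (n - 1) 0\<close> is the nonzero constant
    \<open>n\<close>. The recursion never reaches it, because it lowers \<open>k\<close> below
    \<open>n - 1\<close>.\<close>
  have mem: "S k l \<in> esym_span n" if "k < n" "\<not> (k = n - 1 \<and> l = 0)" for k l
    using that
  proof (induction k arbitrary: l)
    case k0: (0 l)
    show ?case
    proof (cases l)
      case 0
      then show ?thesis
        unfolding \<open>l = 0\<close> deriv using k0 False \<open>l = 0\<close>
        by (intro esym_span_mult coeff_rootp_in_esym_span Lam_of_nat) auto
    next
      case (Suc l')
      show ?thesis
        unfolding Suc base using False
        by (intro esym_span_mult coeff_rootp_in_esym_span Lam_intros psum_in_Lam) auto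
    qed
  next
    case IH: (Suc k l)
    show ?case
    proof (cases l)
      case 0
      then show ?thesis
        unfolding \<open>l = 0\<close> deriv using IH.prems False \<open>l = 0\<close>
        by (intro esym_span_mult coeff_rootp_in_esym_span Lam_of_nat) auto
    next
      case (Suc l')
      have "S k l' \<in> esym_span n"
        using IH.prems by (intro IH.IH) auto
      then show ?thesis
        unfolding Suc step using IH.prems
        by (intro esym_span_diff esym_span_mult coeff_rootp_in_esym_span psum_in_Lam) auto
    qed
  qed
  \<comment> \<open>Each \<open>q i\<close> is monic of degree \<open>n - 1\<close>, so the values
    of \<open>S\<close> at \<open>k = n - 1\<close> are the power sums themselves.\<close>
  have "coeff (q i) (n - 1) = 1" if "i \<in> {1..n}" for i
    using that degree_prod_linear[of "{1..n} - {i}"] by (simp add: q_def)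
  then have "S (n - 1) l = psum {1..n} l"
    by (simp add: S_def psum_def)
  then show ?thesis
    using mem[of "n - 1" l] False assms by auto
qed

text \<open>Power sums generate \<open>\<Lambda>\<close>, and they lie in the ideal except for
  exponent 0, which gives \<open>n\<close>. Modulo the ideal, coefficients in
  \<open>\<Lambda>\<close> can thus be replaced by rational constants.\<close>

lemma Lam_decompose:
  assumes "p \<in> Lam n"
  shows "\<exists>c. p - Const c \<in> esym_span n"
proof -
  have "p \<in> subalg (X ` {} \<union> range (psum {1..n}))"
    using assms by (intro symmetric_in_subalg_psum) (auto simp: Lam_def polys_eq_subalg)
  \<comment> \<open>Membership in \<open>\<Lambda>\<close> is carried along because the product case
    multiplies a member of the ideal by \<open>q\<close>.\<close>
  then have "p \<in> Lam n \<and> (\<exists>c. p - Const c \<in> esym_span n)"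
  proof induction
    case (Const c)
    have "(\<Sum>k\<in>{1..n}. elem_sym n k * 0) \<in> esym_span n"
      by (intro esym_spanI Lam_intros)
    then have "Const c - Const c \<in> esym_span n" by simp
    then show ?case using Lam_intros(1) by blast
  next
    case (gen g)
    then obtain l where l: "g = psum {1..n} l" by auto
    have "\<exists>c. g - Const c \<in> esym_span n"
    proof (cases "l = 0")
      case True
      have "(\<Sum>k\<in>{1..n}. elem_sym n k * 0) \<in> esym_span n"
        by (intro esym_spanI Lam_intros)
      then have "g - Const (of_nat n) \<in> esym_span n"
        using True by (simp add: l psum_def Const_of_nat)
      then show ?thesis ..
    next
      case False
      then have "g - Const 0 \<in> esym_span n"
        using psum_in_esym_span by (simp add: l)
      then show ?thesis ..
    qed
    then show ?case using l psum_in_Lam by blast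
  next
    case (add p q)
    then obtain c d where "p - Const c \<in> esym_span n" "q - Const d \<in> esym_span n" by blast
    then have "(p + q) - Const (c + d) \<in> esym_span n"
      using esym_span_add by (fastforce simp: Const_add algebra_simps)
    then show ?case using add by (auto intro: Lam_intros)
  next
    case (mult p q)
    then obtain c d where "p - Const c \<in> esym_span n" "q - Const d \<in> esym_span n" by blast
    moreover have "p * q - Const (c * d) = q * (p - Const c) + Const c * (q - Const d)"
      by (simp add: Const_mult algebra_simps)
    ultimately have "p * q - Const (c * d) \<in> esym_span n"
      using mult by (auto intro!: esym_span_add esym_span_mult Lam_intros)
    then show ?case using mult by (auto intro: Lam_intros)
  qed
  then show ?thesis ..
qed

section \<open>Formal integrals\<close>

lemma Const_inverse_Suc: "Const (1 / of_nat (Suc i)) * of_nat (Suc i) = 1"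
  by (simp flip: Const_of_nat Const_mult del: of_nat_Suc)

lemma pderiv_sum: "pderiv (\<Sum>i\<in>S. f i) = (\<Sum>i\<in>S. pderiv (f i))"
  by (induction S rule: infinite_finite_induct) (simp_all add: pderiv_add)

text \<open>The coefficients contain the rationals, so each power of \<open>t\<close> can be
  integrated. The degree bound serves the comparison of degrees in
  \<open>poly_integral_eq_0_imp\<close>.\<close>

lemma ex_antiderivative: "\<exists>G. pderiv G = F \<and> degree G \<le> Suc (degree (F :: qpoly poly))"
proof (intro exI conjI)
  let ?G = "\<Sum>i\<le>degree F. monom (Const (1 / of_nat (Suc i)) * coeff F i) (Suc i)"
  have "pderiv ?G = (\<Sum>i\<le>degree F. monom (coeff F i) i)"
    unfolding pderiv_sum
  proof (rule sum.cong[OF refl])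
    fix i
    show "pderiv (monom (Const (1 / of_nat (Suc i)) * coeff F i) (Suc i)) = monom (coeff F i) i"
      using Const_inverse_Suc[of i]
      by (simp add: pderiv_monom mult.assoc[symmetric] mult.commute[of "of_nat (Suc i)"]
          del: of_nat_Suc)
  qed
  then show "pderiv ?G = F" by (simp add: poly_as_sum_of_monoms)
  show "degree ?G \<le> Suc (degree F)"
    by (rule degree_sum_le) (auto intro: order_trans[OF degree_monom_le])
qed

lemma poly_integral_superset:
  assumes "degree F \<le> N"
  shows "poly_integral a b F
    = (\<Sum>i\<le>N. Const (1 / of_nat (i + 1)) * coeff F i * (b ^ (i + 1) - a ^ (i + 1)))"
  unfolding poly_integral_def
  by (rule sum.mono_neutral_left) (use assms in \<open>auto simp: coeff_eq_0\<close>)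

text \<open>The fundamental theorem of calculus. Together with \<open>ex_antiderivative\<close> it
  reduces linearity and additivity in the endpoints to facts about evaluation.\<close>

lemma poly_integral_pderiv: "poly_integral a b (pderiv G) = poly G b - poly G a"
proof -
  have "poly_integral a b (pderiv G)
      = (\<Sum>i\<le>degree G. coeff G (Suc i) * (b ^ Suc i - a ^ Suc i))"
    unfolding poly_integral_superset[OF order_trans[OF eq_imp_le[OF degree_pderiv] diff_le_self]]
  proof (rule sum.cong[OF refl])
    fix i
    have "Const (1 / of_nat (Suc i)) * coeff (pderiv G) i = coeff G (Suc i)"
      using Const_inverse_Suc[of i]
      by (simp add: coeff_pderiv mult.assoc[symmetric] del: of_nat_Suc)
    then show "Const (1 / of_nat (i + 1)) * coeff (pderiv G) i * (b ^ (i + 1) - a ^ (i + 1))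
        = coeff G (Suc i) * (b ^ Suc i - a ^ Suc i)"
      unfolding Suc_eq_plus1 by simp
  qed
  also have "\<dots> = (\<Sum>i\<le>Suc (degree G). coeff G i * (b ^ i - a ^ i))"
    by (subst sum.atMost_Suc_shift) simp
  also have "\<dots> = (\<Sum>i\<le>degree G. coeff G i * (b ^ i - a ^ i))"
    by (simp add: coeff_eq_0)
  also have "\<dots> = poly G b - poly G a"
    by (simp add: poly_altdef right_diff_distrib sum_subtractf)
  finally show ?thesis .
qed

lemma poly_integral_add: "poly_integral a b (F + G) = poly_integral a b F + poly_integral a b G"
proof -
  obtain F' G' where "pderiv F' = F" "pderiv G' = G"
    using ex_antiderivative by meson
  then show ?thesis
    using poly_integral_pderiv[of a b "F' + G'"] by (auto simp: pderiv_add poly_integral_pderiv)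
qed

lemma poly_integral_smult: "poly_integral a b (Polynomial.smult c F) = c * poly_integral a b F"
proof -
  obtain F' where "pderiv F' = F"
    using ex_antiderivative by meson
  then show ?thesis
    using poly_integral_pderiv[of a b "Polynomial.smult c F'"]
    by (auto simp: pderiv_smult poly_integral_pderiv algebra_simps)
qed

lemma poly_integral_uminus: "poly_integral a b (- F) = - poly_integral a b F"
  using poly_integral_smult[of a b "- 1" F] by simp

lemma poly_integral_0 [simp]: "poly_integral a b 0 = 0"
  by (simp add: poly_integral_def)

lemma poly_integral_sum:
  "poly_integral a b (\<Sum>i\<in>S. f i) = (\<Sum>i\<in>S. poly_integral a b (f i))"
  by (induction S rule: infinite_finite_induct) (auto simp: poly_integral_add)

lemma poly_integral_trans: "poly_integral a b F + poly_integral b c F = poly_integral a c F"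
proof -
  obtain F' where "pderiv F' = F"
    using ex_antiderivative by meson
  then show ?thesis by (auto simp: poly_integral_pderiv)
qed

lemma poly_integral_refl [simp]: "poly_integral a a F = 0"
  by (simp add: poly_integral_def)

lemma poly_integral_swap: "poly_integral b a F = - poly_integral a b F"
  using poly_integral_trans[of a b F a] by (simp add: add_eq_0_iff)

lemma poly_integral_by_parts:
  "poly_integral a b (pderiv F * G)
    = poly F b * poly G b - poly F a * poly G a - poly_integral a b (F * pderiv G)"
  using poly_integral_pderiv[of a b "F * G"]
  by (simp add: pderiv_mult poly_integral_add algebra_simps)

lemma perm_act_poly_integral:
  assumes "F \<in> LamP n" "\<sigma> permutes {1..n}"
  shows "perm_act \<sigma> (poly_integral a b F) = poly_integral (perm_act \<sigma> a) (perm_act \<sigma> b) F"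
  unfolding poly_integral_def perm_act_sum
  using assms(1) by (intro sum.cong refl) (simp add: LamP_def Lam_fixed[OF _ assms(2)])

lemma poly_integral_in_polys:
  assumes "F \<in> LamP n" "a \<in> {1..n}" "b \<in> {1..n}"
  shows "poly_integral (X a) (X b) F \<in> polys n"
proof -
  have "coeff F k \<in> subalg (X ` {1..n})" for k
    using assms(1) Lam_polys unfolding LamP_def polys_eq_subalg by blast
  moreover have "X a \<in> subalg (X ` {1..n})" "X b \<in> subalg (X ` {1..n})"
    using assms by (auto intro: subalg.gen)
  ultimately show ?thesis
    unfolding poly_integral_def polys_eq_subalg
    by (intro subalg_sum subalg.mult subalg.Const subalg_diff subalg_power)
qed

text \<open>The integral of \<open>(t - a)\<^sup>i (t - b)\<^sup>l\<close> from \<open>a\<close> to \<open>b\<close>, in units of \<open>(b - a)\<^bsup>i + l + 1\<^esup>\<close>.\<close>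

fun beta_coeff :: "nat \<Rightarrow> nat \<Rightarrow> rat" where
  "beta_coeff i 0 = 1 / of_nat (Suc i)"
| "beta_coeff i (Suc l) = - (of_nat (Suc l) / of_nat (Suc i)) * beta_coeff (Suc i) l"

lemma beta_coeff_neq_0: "beta_coeff i l \<noteq> 0"
  by (induction l arbitrary: i) (auto simp del: of_nat_Suc)

lemma pderiv_linear_power_Suc: "pderiv ([:- a, 1:] ^ Suc i)
    = Polynomial.smult (of_nat (Suc i)) ([:- a, 1:] ^ i)" for a :: qpoly
  by (simp add: pderiv_power_Suc pderiv_pCons del: of_nat_Suc power_Suc)

text \<open>Integration by parts lowers the exponent of \<open>t - b\<close> and raises that of
  \<open>t - a\<close>. The boundary terms vanish because both exponents in them are
  positive.\<close>

lemma poly_integral_beta: "poly_integral a b ([:- a, 1:] ^ i * [:- b, 1:] ^ l)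
    = Const (beta_coeff i l) * (b - a) ^ (i + l + 1)"
proof (induction l arbitrary: i)
  have antideriv: "[:- a, 1:] ^ i
      = pderiv (Polynomial.smult (Const (1 / of_nat (Suc i))) ([:- a, 1:] ^ Suc i))" for i
    using Const_inverse_Suc[of i]
    by (simp add: pderiv_smult pderiv_linear_power_Suc del: of_nat_Suc power_Suc)
  {
    case 0
    show ?case
      unfolding power_0 mult_1_right antideriv[of i] poly_integral_pderiv by (simp add: One_nat_def left_diff_distrib)
  next
    case (Suc l)
    have "poly_integral a b ([:- a, 1:] ^ i * [:- b, 1:] ^ Suc l) = - poly_integral a b
        (Polynomial.smult (Const (1 / of_nat (Suc i))) ([:- a, 1:] ^ Suc i) *
         Polynomial.smult (of_nat (Suc l)) ([:- b, 1:] ^ l))"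
      unfolding antideriv[of i] poly_integral_by_parts pderiv_linear_power_Suc by simp
    also have "\<dots> = - (Const (1 / of_nat (Suc i)) * of_nat (Suc l) *
        (Const (beta_coeff (Suc i) l) * (b - a) ^ (Suc i + l + 1)))"
      by (simp only: mult_smult_left mult_smult_right poly_integral_smult Suc.IH) (simp add: mult_ac)
    also have "\<dots> = Const (beta_coeff i (Suc l)) * (b - a) ^ (i + Suc l + 1)"
    proof -
      have "Const (beta_coeff i (Suc l))
          = - (Const (1 / of_nat (Suc i)) * of_nat (Suc l) * Const (beta_coeff (Suc i) l))"
        unfolding Const_of_nat[symmetric] Const_mult[symmetric] Const_minus[symmetric] by simp
      then show ?thesis by (simp only: mult.assoc minus_mult_left[symmetric]) simp
    qed
    finally show ?case .
  }
qed

text \<open>Write \<open>R = (t - a) S + R(a)\<close>. The constant part is a beta integral; the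
  other part has one more factor \<open>t - a\<close>, hence one more factor \<open>b - a\<close>
  after integration. The degree falls while \<open>i\<close> rises, so \<open>i\<close> is arbitrary
  in the induction.\<close>

lemma poly_integral_beta_expand: "\<exists>Y. poly_integral a b (R * ([:- a, 1:] ^ i * [:- b, 1:] ^ l))
    = (b - a) ^ (i + l + 1) * (Const (beta_coeff i l) * poly R a + (b - a) * Y)"
proof (induction "degree R" arbitrary: R i rule: less_induct)
  case less
  define S where "S = synthetic_div R a"
  have R: "R = [:- a, 1:] * S + [:poly R a:]"
    unfolding S_def by (rule synthetic_div_correct'[symmetric])
  have "poly_integral a b (R * ([:- a, 1:] ^ i * [:- b, 1:] ^ l))
      = poly_integral a b (S * ([:- a, 1:] ^ Suc i * [:- b, 1:] ^ l))
        + poly_integral a b (Polynomial.smult (poly R a) ([:- a, 1:] ^ i * [:- b, 1:] ^ l))"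
  proof -
    have "R * ([:- a, 1:] ^ i * [:- b, 1:] ^ l) = S * ([:- a, 1:] ^ Suc i * [:- b, 1:] ^ l)
        + [:poly R a:] * ([:- a, 1:] ^ i * [:- b, 1:] ^ l)"
      by (subst R, unfold distrib_right power_Suc) (simp only: mult_ac)
    then show ?thesis by (simp add: poly_integral_add)
  qed
  moreover have "poly_integral a b (Polynomial.smult (poly R a) ([:- a, 1:] ^ i * [:- b, 1:] ^ l))
      = (b - a) ^ (i + l + 1) * (Const (beta_coeff i l) * poly R a)"
    unfolding poly_integral_smult poly_integral_beta by (simp add: mult_ac)
  moreover have "\<exists>Y. poly_integral a b (S * ([:- a, 1:] ^ Suc i * [:- b, 1:] ^ l))
      = (b - a) ^ (i + l + 1) * ((b - a) * Y)"
  proof (cases "degree R = 0")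
    case True
    then have "S = 0" by (simp add: S_def synthetic_div_eq_0_iff)
    then show ?thesis by (intro exI[of _ 0]) (simp add: poly_integral_def)
  next
    case False
    then have "degree S < degree R" by (simp add: S_def degree_synthetic_div)
    then obtain Y where "poly_integral a b (S * ([:- a, 1:] ^ Suc i * [:- b, 1:] ^ l))
        = (b - a) ^ (Suc i + l + 1) * (Const (beta_coeff (Suc i) l) * poly S a + (b - a) * Y)"
      using less by blast
    then show ?thesis by (auto simp: mult_ac)
  qed
  ultimately show ?case
    by (metis (no_types, lifting) add.commute distrib_left)
qed

text \<open>Splitting \<open>t - x_a\<close> and \<open>t - x_b\<close> off \<open>p\<close> reduces
  this to the case \<open>i = l = m\<close> above. The outer power shows that the integrals are
  quasi-invariant; the term of lowest order drives the induction on \<open>m\<close>.\<close>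

lemma poly_integral_rootp_expand:
  assumes "a \<in> {1..n}" "b \<in> {1..n}" "a \<noteq> b"
  shows "\<exists>Y. poly_integral (X a) (X b) (C * rootp n ^ m) = (X b - X a) ^ (2 * m + 1) *
    (Const (beta_coeff m m) * (poly C (X a) * (\<Prod>l\<in>{1..n} - {a, b}. X a - X l) ^ m)
      + (X b - X a) * Y)"
proof -
  let ?w = "\<Prod>l\<in>{1..n} - {a, b}. [:- X l, 1:]"
  have "{1..n} - {a} - {b} = {1..n} - {a, b}" by auto
  then have "rootp n = [:- X a, 1:] * [:- X b, 1:] * ?w"
    unfolding rootp_def using assms
      prod.remove[of "{1..n}" a "\<lambda>i. [:- X i, 1:]"] prod.remove[of "{1..n} - {a}" b "\<lambda>i. [:- X i, 1:]"]
    by (simp only: mult.assoc finite_atLeastAtMost finite_Diff Diff_iff singleton_iff simp_thms)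
  then have eq: "C * rootp n ^ m = (C * ?w ^ m) * ([:- X a, 1:] ^ m * [:- X b, 1:] ^ m)"
    by (simp only: power_mult_distrib mult_ac)
  show ?thesis
    using poly_integral_beta_expand[of "X a" "X b" "C * ?w ^ m" m m]
    unfolding eq by (simp add: poly_prod mult_2)
qed

section \<open>Values of \<open>p'\<close> at the roots, and vanishing integrals\<close>

lemma poly_pderiv_rootp:
  assumes "i \<in> {1..n}"
  shows "poly (pderiv (rootp n)) (X i) = (\<Prod>k\<in>{1..n} - {i}. X i - X k)"
proof -
  have "rootp n = [:- X i, 1:] * (\<Prod>k\<in>{1..n} - {i}. [:- X k, 1:])"
    unfolding rootp_def using assms by (subst prod.remove) auto
  then show ?thesis
    by (simp only: pderiv_mult) (simp add: poly_prod pderiv_pCons)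
qed

lemma poly_pderiv_rootp_neq_0: "i \<in> {1..n} \<Longrightarrow> poly (pderiv (rootp n)) (X i) \<noteq> 0"
  unfolding poly_pderiv_rootp by auto

lemma poly_X_eq_0_transfer:
  assumes "F \<in> LamP n" "j \<in> {1..n}" "poly F (X j) = 0" "i \<in> {1..n}"
  shows "poly F (X i) = 0"
proof -
  have "Transposition.transpose j i permutes {1..n}"
    using assms by (intro permutes_swap_id)
  then show ?thesis
    using perm_act_poly[OF assms(1), of "Transposition.transpose j i" "X j"] assms(3) by simp
qed

text \<open>By symmetry, the antiderivative that vanishes at \<open>x_1\<close> vanishes at every
  \<open>x_i\<close>. Its derivative contains \<open>p^m\<close>, so it is divisible by
  \<open>p^(m+1)\<close>, of degree \<open>n m + n\<close>, while its own degree is at most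
  \<open>n m + n - 1\<close>.\<close>

lemma poly_integral_eq_0_imp:
  assumes C: "C \<in> LamP n" "degree C \<le> n - 2" and j: "j \<in> {1..n}" "j \<noteq> 1"
    and zero: "poly_integral (X 1) (X j) (C * rootp n ^ m) = 0"
  shows "C = 0"
proof -
  have n: "n \<ge> 2" using j by auto
  obtain G where G: "pderiv G = C * rootp n ^ m" "degree G \<le> Suc (degree (C * rootp n ^ m))"
    using ex_antiderivative by blast
  define r where "r = G - [:poly G (X 1):]"
  have pderiv_r: "pderiv r = C * rootp n ^ m"
    by (simp add: r_def pderiv_diff pderiv_pCons G(1))
  have root: "poly r (X i) = 0" if i: "i \<in> {1..n}" for i
  proof (cases "i = 1")
    case False
    have "C * rootp n ^ m \<in> LamP n"
      using C by (intro LamP_intros rootp_in_LamP)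
    moreover have "Transposition.transpose j i permutes {1..n}"
      using i j by (intro permutes_swap_id)
    ultimately have "poly_integral (X 1) (X i) (C * rootp n ^ m) = 0"
      using perm_act_poly_integral[of "C * rootp n ^ m" n "Transposition.transpose j i" "X 1" "X j"]
        zero False j by simp
    then show ?thesis
      unfolding G(1)[symmetric] poly_integral_pderiv by (simp add: r_def)
  qed (simp add: r_def)
  \<comment> \<open>The multiplicity is raised one at a time: if \<open>r = p^(k+1) s\<close> and
    \<open>p^(k+1)\<close> divides \<open>r'\<close>, then \<open>p\<close> divides
    \<open>(k+1) p' s\<close>. As \<open>p'\<close> is nonzero at each \<open>x_i\<close>,
    \<open>s\<close> vanishes there.\<close>
  have "rootp n ^ Suc k dvd r" if "k \<le> m" for k
    using that
  proof (induction k)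
    case 0
    then show ?case using root rootp_dvd by simp
  next
    case (Suc k)
    then obtain s where s: "r = rootp n ^ Suc k * s"
      by (auto elim: dvdE)
    have "pderiv r = rootp n ^ k * (of_nat (Suc k) * pderiv (rootp n) * s)
        + rootp n ^ Suc k * pderiv s"
      unfolding s pderiv_mult pderiv_power_Suc
      by (simp add: of_nat_poly algebra_simps del: of_nat_Suc)
    moreover have "rootp n ^ Suc k dvd pderiv r"
      unfolding pderiv_r using Suc.prems by (intro dvd_mult le_imp_power_dvd)
    ultimately have "rootp n ^ Suc k dvd rootp n ^ k * (of_nat (Suc k) * pderiv (rootp n) * s)"
      by (metis dvd_add_left_iff dvd_triv_left)
    then have "rootp n dvd of_nat (Suc k) * pderiv (rootp n) * s"
      by (simp add: mult.commute[of "rootp n"] del: of_nat_Suc)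
    then have "poly (of_nat (Suc k) * pderiv (rootp n) * s) (X i) = 0" if "i \<in> {1..n}" for i
      using poly_rootp_X[OF that] unfolding dvd_def by (metis mult_zero_left poly_mult)
    then have "poly (pderiv (rootp n)) (X i) * poly s (X i) = 0" if "i \<in> {1..n}" for i
      using that by (simp add: of_nat_poly del: of_nat_Suc)
    then have "poly s (X i) = 0" if "i \<in> {1..n}" for i
      using that poly_pderiv_rootp_neq_0[OF that] mult_eq_0_iff by blast
    then have "rootp n dvd s" by (rule rootp_dvd)
    then show ?case
      unfolding s by (simp only: power_Suc2[of _ "Suc k"]) (rule mult_dvd_mono, simp_all)
  qed
  then have dvd: "rootp n ^ Suc m dvd r" by blast
  have "r = 0"
  proof (rule ccontr)
    assume "r \<noteq> 0"
    then have "n * Suc m \<le> degree r"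
      using dvd_imp_degree_le[OF dvd] by (simp add: degree_power_eq mult.commute del: power_Suc)
    also have "degree r \<le> Suc (degree (C * rootp n ^ m))"
      unfolding r_def using G(2) by (intro degree_diff_le) auto
    also have "\<dots> \<le> Suc (n - 2 + n * m)"
      using degree_mult_le[of C "rootp n ^ m"] C(2) by (simp add: degree_power_eq mult.commute)
    finally show False using n by simp
  qed
  then show "C = 0"
    using pderiv_r by simp
qed

text \<open>The remainder modulo \<open>p\<close> has the same value at \<open>x_j\<close>, because
  \<open>p\<close> vanishes there.\<close>

lemma partially_symmetric_eq_poly_degree:
  assumes j: "j \<in> {1..n}" and p: "p \<in> polys n" "symm_on ({1..n} - {j}) p"
  shows "\<exists>F\<in>LamP n. poly F (X j) = p \<and> degree F < n"
proof -
  obtain F where F: "F \<in> LamP n" "poly F (X j) = p"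
    using partially_symmetric_eq_poly assms by blast
  moreover obtain S R where "R \<in> LamP n" "F = S * rootp n + R" "degree R < n"
    using LamP_divide_rootp[OF F(1)] j by auto
  ultimately show ?thesis
    using poly_rootp_X[OF j] by auto
qed

lemma symm_on_poly_X:
  assumes "F \<in> LamP n"
  shows "symm_on ({1..n} - {j}) (poly F (X j))"
  unfolding symm_on_def
proof (intro allI impI)
  fix \<sigma> assume \<sigma>: "\<sigma> permutes {1..n} - {j}"
  then have "\<sigma> permutes {1..n}" by (rule permutes_subset) auto
  then show "perm_act \<sigma> (poly F (X j)) = poly F (X j)"
    using perm_act_poly[OF assms] \<sigma> by (simp add: permutes_not_in)
qed

text \<open>
  Raising \<open>m\<close> by one: quasi-invariance of the higher order forces
  \<open>C\<close> to agree with \<open>h p'\<close> at the \<open>x\<^sub>i\<close>, where \<open>p = rootp n\<close>.  Writing \<open>C = S p + h p'\<close>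
  and integrating \<open>h p' p\<^sup>m\<close> by parts, where the boundary terms vanish, produces the factor \<open>p\<^bsup>m + 1\<^esup>\<close>.
\<close>

lemma integral_representation:
  assumes n: "n \<ge> 2" and j: "j \<in> {1..n}"
    and f: "f \<in> polys n" "symm_on ({1..n} - {j}) f"
    and qi: "\<And>i. i \<in> {1..n} - {j} \<Longrightarrow>
      (X j - X i) ^ (2 * m + 1) dvd f - perm_act (Transposition.transpose i j) f"
  shows "\<exists>C\<in>LamP n. degree C \<le> n - 2 \<and> (\<forall>i\<in>{1..n}.
    f - perm_act (Transposition.transpose i j) f = poly_integral (X i) (X j) (C * rootp n ^ m))"
  using qi
proof (induction m)
  case 0
  obtain F where F: "F \<in> LamP n" "poly F (X j) = f" "degree F < n"
    using partially_symmetric_eq_poly_degree[OF j f] by blast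
  have "f - perm_act (Transposition.transpose i j) f
      = poly_integral (X i) (X j) (pderiv F * rootp n ^ 0)" if "i \<in> {1..n}" for i
  proof -
    have "Transposition.transpose i j permutes {1..n}"
      using that j by (intro permutes_swap_id)
    then have "perm_act (Transposition.transpose i j) f = poly F (X i)"
      using perm_act_poly[OF F(1)] F(2) by auto
    then show ?thesis by (simp add: poly_integral_pderiv F(2))
  qed
  moreover have "degree (pderiv F) \<le> n - 2"
    using degree_pderiv[of F] F(3) by simp
  ultimately show ?case
    using LamP_pderiv[OF F(1)] by blast
next
  case (Suc m)
  have "(X j - X i) ^ (2 * m + 1) dvd f - perm_act (Transposition.transpose i j) f"
    if "i \<in> {1..n} - {j}" for i
    using Suc.prems[OF that] by (rule dvd_trans[OF le_imp_power_dvd, rotated]) simp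
  then obtain C where C: "C \<in> LamP n" "degree C \<le> n - 2"
    and f_int: "\<And>i. i \<in> {1..n} \<Longrightarrow> f - perm_act (Transposition.transpose i j) f
      = poly_integral (X i) (X j) (C * rootp n ^ m)"
    using Suc.IH by blast
  let ?V = "{1..n} - {j}"
  \<comment> \<open>The term of lowest order in \<open>x_j - x_i\<close> of the integral contains
    \<open>C(x_i)\<close>. Divisibility by two further powers, one of which suffices, forces this
    term to vanish on \<open>x_i = x_j\<close>.\<close>
  have dvd: "(X j - X i) dvd poly C (X j)" if i: "i \<in> ?V" for i
  proof -
    let ?D = "X j - X i" and ?w = "\<Prod>l\<in>{1..n} - {i, j}. X i - X l"
    have ij: "i \<in> {1..n}" "i \<noteq> j" using i by auto
    obtain Y where Y: "poly_integral (X i) (X j) (C * rootp n ^ m) = ?D ^ (2 * m + 1) *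
        (Const (beta_coeff m m) * (poly C (X i) * ?w ^ m) + ?D * Y)"
      using poly_integral_rootp_expand[OF ij(1) j ij(2)] by blast
    have "?D ^ (2 * m + 1) * ?D ^ 2 = ?D ^ (2 * Suc m + 1)"
      by (simp flip: power_add)
    then have "?D ^ (2 * m + 1) * ?D ^ 2 dvd
        ?D ^ (2 * m + 1) * (Const (beta_coeff m m) * (poly C (X i) * ?w ^ m) + ?D * Y)"
      using Suc.prems[OF i] f_int[OF ij(1)] Y by simp
    moreover have "?D ^ (2 * m + 1) \<noteq> 0" using ij by simp
    ultimately have "?D ^ 2 dvd Const (beta_coeff m m) * (poly C (X i) * ?w ^ m) + ?D * Y"
      by (simp only: dvd_mult_cancel_left) simp
    then have "?D dvd Const (beta_coeff m m) * (poly C (X i) * ?w ^ m) + ?D * Y"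
      by (rule dvd_trans[rotated]) (simp add: power2_eq_square)
    then have "?D dvd Const (beta_coeff m m) * (poly C (X i) * ?w ^ m)"
      by (simp add: dvd_add_left_iff)
    \<comment> \<open>On \<open>x_i = x_j\<close> the product \<open>?w\<close> and the beta
      constant remain nonzero, so it is \<open>C(x_i)\<close> that vanishes.\<close>
    then have "subst (X(i := X j)) (Const (beta_coeff m m) * (poly C (X i) * ?w ^ m)) = 0"
      using X_diff_dvd_iff by blast
    moreover have "subst (X(i := X j)) ?w = (\<Prod>l\<in>{1..n} - {i, j}. X j - X l)"
      unfolding subst_prod by (intro prod.cong) auto
    moreover have "(\<Prod>l\<in>{1..n} - {i, j}. X j - X l) \<noteq> 0" by auto
    ultimately have "subst (X(i := X j)) (poly C (X i)) = 0"
      by (simp add: beta_coeff_neq_0)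
    then have "?D dvd poly C (X i)"
      using X_diff_dvd_iff by blast
    then obtain q where q: "poly C (X i) = ?D * q" by (auto elim: dvdE)
    \<comment> \<open>Swapping the two variables passes the divisibility from \<open>C(x_i)\<close>
      to \<open>C(x_j)\<close>, where the conditions for all \<open>i\<close> can be
      combined.\<close>
    have "Transposition.transpose i j permutes {1..n}"
      using ij j by (intro permutes_swap_id)
    then have "poly C (X j) = (X i - X j) * perm_act (Transposition.transpose i j) q"
      using perm_act_poly[OF C(1), of "Transposition.transpose i j" "X i"] q by simp
    then have "poly C (X j) = ?D * - perm_act (Transposition.transpose i j) q"
      by (simp add: algebra_simps)
    then show ?thesis by (metis dvd_triv_left)
  qed
  \<comment> \<open>The product of all these divisors is \<open>p'(x_j)\<close>. The quotient of
    \<open>C(x_j)\<close> by it is again symmetric in the other variables, hence of the form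
    \<open>h(x_j)\<close>.\<close>
  let ?d = "\<Prod>i\<in>?V. X j - X i"
  obtain H where H: "poly C (X j) = ?d * H"
    using prod_X_diff_dvd[of ?V j "poly C (X j)"] dvd by (auto elim: dvdE)
  have d: "?d = poly (pderiv (rootp n)) (X j)"
    using poly_pderiv_rootp[OF j] by simp
  have rootp': "pderiv (rootp n) \<in> LamP n"
    by (intro LamP_intros rootp_in_LamP)
  have d0: "?d \<noteq> 0" by auto
  have "H \<in> polys n"
    using subalg_cancel[of ?d "{1..n}" H] d0 H
      poly_LamP_in_polys[OF C(1) j] poly_LamP_in_polys[OF rootp' j]
    by (simp add: polys_eq_subalg d)
  moreover have "symm_on ?V H"
    using symm_on_cancel[of ?V ?d H] d0 symm_on_poly_X[OF C(1), of j]
      symm_on_poly_X[OF rootp', of j] H by (simp add: d)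
  ultimately obtain h where h: "h \<in> LamP n" "poly h (X j) = H" "degree h < n"
    using partially_symmetric_eq_poly_degree[OF j] by blast
  have Chp: "C - h * pderiv (rootp n) \<in> LamP n"
    by (intro LamP_intros C h rootp_in_LamP)
  then obtain S R where S: "S \<in> LamP n" "C - h * pderiv (rootp n) = S * rootp n + R" "degree R < n"
    using LamP_divide_rootp[OF Chp] n by auto
  \<comment> \<open>\<open>C - h p'\<close> vanishes at \<open>x_j\<close> and, its coefficients
    being symmetric, at every \<open>x_i\<close>. The remainder then has \<open>n\<close> roots but
    degree below \<open>n\<close>.\<close>
  have "poly R (X i) = 0" if "i \<in> {1..n}" for i
  proof -
    have "poly (C - h * pderiv (rootp n)) (X j) = 0"
      by (simp add: H h d)
    then have "poly (C - h * pderiv (rootp n)) (X i) = 0"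
      using poly_X_eq_0_transfer[OF Chp j] that by blast
    then show ?thesis
      unfolding S(2) by (simp add: poly_rootp_X[OF that])
  qed
  then have "rootp n dvd R" by (rule rootp_dvd)
  then have "R = 0"
    using S(3) dvd_imp_degree_le[of "rootp n" R] by auto
  then have C_eq: "C = h * pderiv (rootp n) + S * rootp n"
    using S(2) by (simp add: algebra_simps)
  \<comment> \<open>Both \<open>h\<close> and \<open>p'\<close> have degree at most
    \<open>n - 1\<close>, so \<open>S p\<close> has degree at most \<open>2 n - 2\<close>.\<close>
  have "degree S \<le> n - 2"
  proof (cases "S = 0")
    case False
    have "degree (h * pderiv (rootp n)) \<le> 2 * n - 2"
      using degree_mult_le[of h "pderiv (rootp n)"] h(3) degree_pderiv[of "rootp n"] by simp
    then have "degree (C - h * pderiv (rootp n)) \<le> 2 * n - 2"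
      using C(2) by (intro degree_diff_le) auto
    moreover have "degree (C - h * pderiv (rootp n)) = degree S + n"
      using False \<open>R = 0\<close> by (simp add: S(2) degree_mult_eq)
    ultimately show ?thesis by simp
  qed simp
  \<comment> \<open>Chosen so that \<open>c p^(m+1)\<close> is an antiderivative of
    \<open>p' p^m\<close>, the factor to be integrated by parts.\<close>
  define c where "c = Const (1 / of_nat (Suc m))"
  define C' where "C' = S - Polynomial.smult c (pderiv h)"
  have "C' \<in> LamP n"
    unfolding C'_def c_def by (intro LamP_intros S h Lam_intros)
  moreover have "degree C' \<le> n - 2"
    unfolding C'_def using \<open>degree S \<le> n - 2\<close> h(3) degree_pderiv[of h]
    by (intro degree_diff_le order_trans[OF degree_smult_le]) auto
  moreover have "poly_integral (X i) (X j) (C * rootp n ^ m)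
      = poly_integral (X i) (X j) (C' * rootp n ^ Suc m)" if i: "i \<in> {1..n}" for i
  proof -
    let ?F = "Polynomial.smult c (rootp n ^ Suc m)"
    have pF: "pderiv ?F = pderiv (rootp n) * rootp n ^ m"
      using Const_inverse_Suc[of m]
      by (simp add: pderiv_smult pderiv_power_Suc c_def mult_ac del: power_Suc of_nat_Suc)
    have "poly ?F (X i) = 0" and "poly ?F (X j) = 0"
      by (simp_all add: poly_rootp_X[OF i] poly_rootp_X[OF j])
    then have "poly_integral (X i) (X j) (pderiv ?F * h) = - poly_integral (X i) (X j) (?F * pderiv h)"
      unfolding poly_integral_by_parts by (simp only: mult_zero_left diff_self diff_0)
    moreover have "C * rootp n ^ m = pderiv ?F * h + S * rootp n ^ Suc m"
      unfolding C_eq pF by (simp add: algebra_simps)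
    moreover have "C' * rootp n ^ Suc m = - (?F * pderiv h) + S * rootp n ^ Suc m"
      unfolding C'_def by (simp add: algebra_simps)
    ultimately show ?thesis
      by (simp only: poly_integral_add poly_integral_uminus)
  qed
  ultimately show ?case
    using f_int by (metis (no_types, lifting))
qed

section \<open>The action of the group algebra\<close>

lemma galg_act_add: "galg_act n u (P + Q) = galg_act n u P + galg_act n u Q"
  by (simp add: galg_act_def algebra_simps sum.distrib)

text \<open>Every permutation fixes \<open>c\<close>, so the group algebra acts by
  \<open>\<Lambda>\<close>-linear maps. The action descends to the quotient for this reason.\<close>

lemma galg_act_Lam:
  assumes "c \<in> Lam n" shows "galg_act n u (c * P) = c * galg_act n u P"
  unfolding galg_act_def sum_distrib_left
  by (intro sum.cong refl) (use Lam_fixed[OF assms] in \<open>simp add: mult_ac\<close>)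

lemma galg_act_0: "galg_act n u 0 = 0"
  by (simp add: galg_act_def)

lemma galg_act_sum: "galg_act n u (\<Sum>i\<in>S. f i) = (\<Sum>i\<in>S. galg_act n u (f i))"
  by (induction S rule: infinite_finite_induct) (simp_all add: galg_act_add galg_act_0)

lemma Const_sum: "Const (\<Sum>i\<in>S. f i) = (\<Sum>i\<in>S. Const (f i))"
  by (induction S rule: infinite_finite_induct) (simp_all add: Const_add)

lemma galg_act_mult: "galg_act n (galg_mult n u v) P = galg_act n u (galg_act n v P)"
proof -
  let ?S = "{\<sigma>. \<sigma> permutes {1..n}}"
  let ?h = "\<lambda>x. Const (u (fst x)) * Const (v (snd x)) * perm_act (fst x \<circ> snd x) P"
  have fin: "finite ?S" by (simp add: finite_permutations)
  have "galg_act n (galg_mult n u v) P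
      = (\<Sum>\<rho>\<in>?S. sum ?h {x \<in> ?S \<times> ?S. fst x \<circ> snd x = \<rho>})"
    unfolding galg_act_def
  proof (rule sum.cong[OF refl])
    fix \<rho>
    have set_eq: "{(\<sigma>, \<tau>). \<sigma> permutes {1..n} \<and> \<tau> permutes {1..n} \<and> \<sigma> \<circ> \<tau> = \<rho>}
        = {x \<in> ?S \<times> ?S. fst x \<circ> snd x = \<rho>}" by auto
    show "Const (galg_mult n u v \<rho>) * perm_act \<rho> P
        = sum ?h {x \<in> ?S \<times> ?S. fst x \<circ> snd x = \<rho>}"
      unfolding galg_mult_def set_eq Const_sum sum_distrib_right
      by (intro sum.cong refl) (auto simp: Const_mult)
  qed
  also have "\<dots> = sum ?h (?S \<times> ?S)"
    by (rule sum.group) (auto simp: fin intro: permutes_compose)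
  also have "\<dots> = (\<Sum>\<sigma>\<in>?S. \<Sum>\<tau>\<in>?S. Const (u \<sigma>) * Const (v \<tau>) * perm_act (\<sigma> \<circ> \<tau>) P)"
    by (simp add: sum.cartesian_product case_prod_beta)
  also have "\<dots> = galg_act n u (galg_act n v P)"
    by (simp add: galg_act_def perm_act_sum perm_act_comp sum_distrib_left mult_ac)
  finally show ?thesis .
qed

lemma galg_act_supported:
  assumes "V \<subseteq> {1..n}" "\<And>\<sigma>. \<sigma> permutes {1..n} \<Longrightarrow> \<not> \<sigma> permutes V \<Longrightarrow> u \<sigma> = 0"
  shows "galg_act n u P = (\<Sum>\<sigma> | \<sigma> permutes V. Const (u \<sigma>) * perm_act \<sigma> P)"
  unfolding galg_act_def
  by (rule sum.mono_neutral_right)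
    (use assms in \<open>auto simp: finite_permutations intro: permutes_subset\<close>)

lemma galg_act_one: "galg_act n galg_one P = P"
proof -
  have "galg_act n galg_one P = (\<Sum>\<sigma> | \<sigma> permutes {}. Const (galg_one \<sigma>) * perm_act \<sigma> P)"
    by (rule galg_act_supported) (auto simp: galg_one_def)
  then show ?thesis by (simp add: galg_one_def)
qed

lemma alt_sum_singleton: "alt_sum {a} = galg_one"
  by (rule ext) (auto simp: alt_sum_def galg_one_def sign_id)

lemma sym_sum_singleton: "sym_sum {a} = galg_one"
  by (rule ext) (auto simp: sym_sum_def galg_one_def)

lemma galg_act_alt_sum_pair:
  assumes "a \<noteq> b" "{a, b} \<subseteq> {1..n}"
  shows "galg_act n (alt_sum {a, b}) P = P - perm_act (Transposition.transpose a b) P"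
proof -
  have "galg_act n (alt_sum {a, b}) P
      = (\<Sum>\<sigma> | \<sigma> permutes {a, b}. Const (alt_sum {a, b} \<sigma>) * perm_act \<sigma> P)"
    by (rule galg_act_supported[OF assms(2)]) (simp add: alt_sum_def)
  also have "{\<sigma>. \<sigma> permutes {a, b}} = {id, Transposition.transpose a b}"
    by (auto simp only: permutes_doubleton_iff)
  also have "(\<Sum>\<sigma>\<in>{id, Transposition.transpose a b}. Const (alt_sum {a, b} \<sigma>) * perm_act \<sigma> P)
      = P - perm_act (Transposition.transpose a b) P"
  proof -
    have "id \<noteq> Transposition.transpose a b"
      using assms(1) by (metis id_apply transpose_apply_first)
    moreover have "alt_sum {a, b} id = 1"
      by (simp add: alt_sum_def permutes_id)
    moreover have "alt_sum {a, b} (Transposition.transpose a b) = - 1"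
      using assms(1) by (simp add: alt_sum_def permutes_swap_id sign_swap_id)
    ultimately show ?thesis by (simp add: Const_neg_1)
  qed
  finally show ?thesis .
qed

lemma galg_act_sym_sum:
  assumes "V \<subseteq> {1..n}"
  shows "galg_act n (sym_sum V) P = (\<Sum>\<sigma> | \<sigma> permutes V. perm_act \<sigma> P)"
proof -
  have "galg_act n (sym_sum V) P = (\<Sum>\<sigma> | \<sigma> permutes V. Const (sym_sum V \<sigma>) * perm_act \<sigma> P)"
    by (rule galg_act_supported[OF assms]) (simp add: sym_sum_def)
  then show ?thesis by (simp add: sym_sum_def)
qed

lemma galg_act_foldr:
  "galg_act n (foldr (galg_mult n) us galg_one) P = foldr (galg_act n) us P"
  by (induction us) (simp_all add: galg_act_one galg_act_mult)

lemma foldr_galg_act_one: "set us \<subseteq> {galg_one} \<Longrightarrow> foldr (galg_act n) us P = P"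
  by (induction us) (auto simp: galg_act_one)

lemma galg_act_scale: "galg_act n (\<lambda>\<sigma>. c * u \<sigma>) P = Const c * galg_act n u P"
  by (simp add: galg_act_def Const_mult sum_distrib_left mult_ac)

section \<open>The tableau of shape \<open>[n - 1, 1]\<close> and its element
  \<open>gamma n T\<close>\<close>

locale hook_tableau =
  fixes n :: nat and T :: "nat \<times> nat \<Rightarrow> nat" and j :: nat
  assumes n: "n \<ge> 2" and T: "standard_tableau [n - 1, 1] T" and j_def: "j = T (1, 0)"
begin

lemma cells_eq: "cells [n - 1, 1] = insert (1, 0) ((\<lambda>c. (0, c)) ` {..<n - 1})"
  by (auto simp: cells_def less_Suc_eq nth_Cons' split: if_splits)

lemma T_bij: "bij_betw T (insert (1, 0) ((\<lambda>c. (0, c)) ` {..<n - 1})) {1..n}"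
  using T n unfolding standard_tableau_def cells_eq by simp

lemma j_in: "j \<in> {1..n}"
  using bij_betw_apply[OF T_bij, of "(1, 0)"] by (simp add: j_def)

text \<open>Every other cell lies in the row or the column of the corner, so its entry is larger and
  the entry 1 must be in the corner.\<close>

lemma T_00: "T (0, 0) = 1"
proof -
  have in_cells: "(0, 0) \<in> cells [n - 1, 1]" "(1, 0) \<in> cells [n - 1, 1]"
    using n by (auto simp: cells_eq)
  have "T (0, 0) \<in> {1..n}"
    using bij_betw_apply[OF T_bij, of "(0, 0)"] n by auto
  moreover have "T (0, 0) \<le> 1"
  proof -
    have "1 \<in> T ` cells [n - 1, 1]"
      using bij_betw_imp_surj_on[OF T_bij] n by (simp add: cells_eq)
    then obtain x where x: "x \<in> cells [n - 1, 1]" "T x = 1" by auto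
    then consider "x = (1, 0)" | c where "x = (0, c)" by (auto simp: cells_eq)
    then show ?thesis
    proof cases
      case 1
      have "T (0, 0) < T (1, 0)"
        using T in_cells unfolding standard_tableau_def by (metis zero_less_one)
      then show ?thesis using 1 x by simp
    next
      case 2
      show ?thesis
      proof (cases "c = 0")
        case False
        then have "T (0, 0) < T (0, c)"
          using T in_cells x(1) unfolding standard_tableau_def 2 by blast
        then show ?thesis using 2 x by simp
      qed (use 2 x in simp)
    qed
  qed
  ultimately show ?thesis by simp
qed

lemma j_notin_row: "j \<notin> T ` ((\<lambda>c. (0, c)) ` {..<n - 1})"
proof -
  have "(\<lambda>c. (0 :: nat, c)) ` {..<n - 1} - {(1, 0)} = (\<lambda>c. (0, c)) ` {..<n - 1}"
    by auto
  then show ?thesis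
    using bij_betw_imp_inj_on[OF T_bij] unfolding inj_on_insert j_def by metis
qed

lemma j_neq_1: "j \<noteq> 1"
proof -
  have "T (0, 0) \<in> T ` ((\<lambda>c. (0, c)) ` {..<n - 1})"
    using n by (intro imageI) auto
  then show ?thesis
    using j_notin_row T_00 by metis
qed

lemma tab_row_0: "tab_row [n - 1, 1] T 0 = {1..n} - {j}"
proof -
  have "T ` ((\<lambda>c. (0, c)) ` {..<n - 1}) = {1..n} - {T (1, 0)}"
    using bij_betw_imp_surj_on[OF T_bij] j_notin_row unfolding j_def
    by (metis Diff_insert_absorb image_insert)
  moreover have "tab_row [n - 1, 1] T 0 = T ` ((\<lambda>c. (0, c)) ` {..<n - 1})"
    by (auto simp: tab_row_def cells_eq)
  ultimately show ?thesis by (simp add: j_def)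
qed

lemma tab_row_1: "tab_row [n - 1, 1] T 1 = {j}"
  by (auto simp: tab_row_def cells_eq j_def)

lemma tab_col_0: "tab_col [n - 1, 1] T 0 = {1, j}"
proof -
  have "tab_col [n - 1, 1] T 0 = {T (0, 0), T (1, 0)}"
    using n by (auto simp: tab_col_def cells_eq)
  then show ?thesis by (simp add: T_00 j_def)
qed

lemma tab_col_pos: "0 < c \<Longrightarrow> c < n - 1 \<Longrightarrow> tab_col [n - 1, 1] T c = {T (0, c)}"
  by (auto simp: tab_col_def cells_eq)

text \<open>Columns other than the first have one cell and act trivially, which leaves the first
  column with entries 1 and \<open>j\<close>.\<close>

lemma galg_act_tab_N:
  "galg_act n (tab_N n [n - 1, 1] T) P = P - perm_act (Transposition.transpose 1 j) P"
proof -
  let ?f = "\<lambda>c. alt_sum (tab_col [n - 1, 1] T c)"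
  have "[0..<n - 1] = 0 # [1..<n - 1]"
    using n by (simp add: upt_conv_Cons One_nat_def)
  then have "galg_act n (tab_N n [n - 1, 1] T) P
      = galg_act n (alt_sum {1, j}) (foldr (galg_act n) (map ?f [1..<n - 1]) P)"
    unfolding tab_N_def galg_act_foldr by (simp add: tab_col_0)
  also have "foldr (galg_act n) (map ?f [1..<n - 1]) P = P"
    by (rule foldr_galg_act_one) (auto simp: tab_col_pos alt_sum_singleton)
  also have "galg_act n (alt_sum {1, j}) P = P - perm_act (Transposition.transpose 1 j) P"
    using j_neq_1 j_in n by (intro galg_act_alt_sum_pair) auto
  finally show ?thesis .
qed

abbreviation row_sum :: "qpoly \<Rightarrow> qpoly" where
  "row_sum P \<equiv> \<Sum>\<sigma> | \<sigma> permutes {1..n} - {j}. perm_act \<sigma> P"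

lemma galg_act_tab_P: "galg_act n (tab_P n [n - 1, 1] T) P = row_sum P"
proof -
  have "[0..<length [n - 1, 1]] = [0, 1]"
    by (simp add: upt_conv_Cons One_nat_def)
  then have "tab_P n [n - 1, 1] T = foldr (galg_mult n) [sym_sum ({1..n} - {j}), galg_one] galg_one"
    unfolding tab_P_def by (simp only: list.map tab_row_0 tab_row_1 sym_sum_singleton)
  then show ?thesis
    by (simp add: galg_act_sym_sum galg_act_one galg_act_mult)
qed

lemma galg_act_gamma: "galg_act n (gamma n T) P = Const (of_nat (n - 1) / fact n) *
    (row_sum P - perm_act (Transposition.transpose 1 j) (row_sum P))"
proof -
  have "gamma n T = (\<lambda>\<sigma>. of_nat (n - 1) / fact n *
      galg_mult n (tab_N n [n - 1, 1] T) (tab_P n [n - 1, 1] T) \<sigma>)"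
    by (simp add: fun_eq_iff gamma_def)
  then show ?thesis
    by (simp only: galg_act_scale galg_act_mult galg_act_tab_N galg_act_tab_P)
qed

lemma Q_int_eq: "Q_int n j k m = poly_integral (X 1) (X j) ([:0, 1:] ^ k * rootp n ^ m)"
  by (simp add: Q_int_def rootp_def prod_power_distrib)

lemma Q_integrand_LamP: "[:0, 1:] ^ k * rootp n ^ m \<in> LamP n"
  by (intro LamP_mult LamP_power rootp_in_LamP LamP_pCons LamP_0 Lam_intros)

text \<open>Families of \<open>n - 1\<close> coefficients correspond to polynomials \<open>C\<close>
  of degree at most \<open>n - 2\<close>, so statements about combinations of the integrals become
  statements about one integrand \<open>C p^m\<close>.\<close>

lemma sum_Q_int:
  "(\<Sum>k<n - 1. c k * Q_int n j k m)
    = poly_integral (X 1) (X j) ((\<Sum>k<n - 1. monom (c k) k) * rootp n ^ m)"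
  by (simp add: sum_distrib_right poly_integral_sum Q_int_eq monom_altdef
      poly_integral_smult[symmetric])

lemma Q_int_independent:
  assumes "\<And>k. c k \<in> Lam n" "(\<Sum>k<n - 1. c k * Q_int n j k m) = 0" "k < n - 1"
  shows "c k = 0"
proof -
  let ?C = "\<Sum>k<n - 1. monom (c k) k"
  have coeff_C: "coeff ?C i = (if i < n - 1 then c i else 0)" for i
    by (simp add: coeff_sum)
  have "?C = 0"
  proof (rule poly_integral_eq_0_imp)
    show "?C \<in> LamP n"
      using assms(1) by (auto simp: LamP_def coeff_C Lam_intros)
    show "degree ?C \<le> n - 2"
      by (rule degree_le) (auto simp: coeff_C)
    show "poly_integral (X 1) (X j) (?C * rootp n ^ m) = 0"
      using assms(2) by (simp add: sum_Q_int)
  qed (use j_in j_neq_1 in auto)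
  then show ?thesis
    using coeff_C[of k] assms(3) by simp
qed

text \<open>
  The permutations \<open>\<sigma>\<close> fixing \<open>1\<close> contribute \<open>2\<close> and all others \<open>1\<close>,
  in total \<open>(n - 1)! + (n - 2)! = n! / (n - 1)\<close>.
\<close>

lemma gamma_Q_int: "galg_act n (gamma n T) (Q_int n j k m) = Q_int n j k m"
proof -
  let ?F = "[:0, 1:] ^ k * rootp n ^ m" and ?V = "{1..n} - {j}"
  let ?S = "{\<sigma>. \<sigma> permutes ?V}" and ?tr = "Transposition.transpose 1 j"
  \<comment> \<open>This integral is additive in its endpoints and a permutation acts on it through
    them, so only the two indices need to be tracked.\<close>
  define J where "J a b = poly_integral (X a) (X b) ?F" for a b
  have J_trans: "J a b + J b c = J a c" for a b c
    by (simp add: J_def poly_integral_trans)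
  have J_refl: "J a a = 0" for a
    by (simp add: J_def)
  have J_perm: "perm_act \<sigma> (J a b) = J (\<sigma> a) (\<sigma> b)" if "\<sigma> permutes {1..n}" for \<sigma> a b
    using perm_act_poly_integral[OF Q_integrand_LamP that] by (simp add: J_def)
  have tr: "?tr permutes {1..n}"
    using j_in n by (intro permutes_swap_id) auto
  have perm: "\<sigma> permutes {1..n}" if "\<sigma> \<in> ?S" for \<sigma>
    using that by (auto intro: permutes_subset)
  \<comment> \<open>If \<open>\<sigma>\<close> fixes 1, the difference is
    \<open>J 1 j - J j 1\<close>, twice \<open>J 1 j\<close>. Otherwise \<open>\<sigma> 1\<close> is
    neither 1 nor \<open>j\<close>, the transposition fixes it, and additivity gives
    \<open>J 1 j\<close> once.\<close>
  have summand: "J (\<sigma> 1) j - J (?tr (\<sigma> 1)) 1 = J 1 j + (if \<sigma> 1 = 1 then J 1 j else 0)"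
    if "\<sigma> \<in> ?S" for \<sigma>
  proof (cases "\<sigma> 1 = 1")
    case True
    then show ?thesis using J_trans[of 1 j 1] by (simp add: J_refl eq_neg_iff_add_eq_0 algebra_simps)
  next
    case False
    have "\<sigma> 1 \<noteq> j"
      using that j_neq_1 by (metis mem_Collect_eq permutes_not_in insert_Diff_single insertI1 DiffE permutes_def)
    then have "?tr (\<sigma> 1) = \<sigma> 1" using False by simp
    then show ?thesis using False J_trans[of "\<sigma> 1" 1 j] by (simp add: algebra_simps)
  qed
  have "row_sum (J 1 j) = (\<Sum>\<sigma>\<in>?S. J (\<sigma> 1) j)"
    by (intro sum.cong refl) (use perm in \<open>auto simp: J_perm permutes_not_in\<close>)
  then have "row_sum (J 1 j) - perm_act ?tr (row_sum (J 1 j))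
      = (\<Sum>\<sigma>\<in>?S. J (\<sigma> 1) j - J (?tr (\<sigma> 1)) 1)"
    by (simp add: perm_act_sum J_perm[OF tr] sum_subtractf)
  also have "\<dots> = (\<Sum>\<sigma>\<in>?S. J 1 j + (if \<sigma> 1 = 1 then J 1 j else 0))"
    using summand by (intro sum.cong refl)
  also have "\<dots> = of_nat (card ?S + card {\<sigma> \<in> ?S. \<sigma> 1 = 1}) * J 1 j"
    by (simp add: sum.distrib sum.inter_filter[symmetric] finite_permutations algebra_simps)
  also have "card ?S + card {\<sigma> \<in> ?S. \<sigma> 1 = 1} = fact (n - 1) + fact (n - 2)"
  proof -
    have "{\<sigma> \<in> ?S. \<sigma> 1 = 1} = {\<sigma>. \<sigma> permutes ?V - {1}}"
      by (auto simp: permutes_not_in intro: permutes_subset permutes_superset)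
    moreover have "card ?V = n - 1" "card (?V - {1}) = n - 2"
      using j_in j_neq_1 n by (auto simp: card_Diff_singleton)
    ultimately show ?thesis
      by (simp add: card_permutations)
  qed
  finally have "galg_act n (gamma n T) (J 1 j)
      = Const (of_nat (n - 1) / fact n * of_nat (fact (n - 1) + fact (n - 2))) * J 1 j"
    unfolding galg_act_gamma by (simp only: Const_mult Const_of_nat mult.assoc)
  also have "of_nat (n - 1) / fact n * of_nat (fact (n - 1) + fact (n - 2)) = (1 :: rat)"
  proof -
    define l where "l = n - 2"
    then have l: "n = Suc (Suc l)" using n by simp
    define F where "F = (fact l :: rat)"
    define N where "N = (of_nat l :: rat)"
    have "F \<noteq> 0" "N + 1 \<noteq> 0" "N + 2 \<noteq> 0"
      by (simp_all add: F_def N_def)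
    moreover have "of_nat (n - 1) = N + 1" "fact n = (N + 2) * ((N + 1) * F)"
      "of_nat (fact (n - 1) + fact (n - 2)) = (N + 1) * F + F"
      by (simp_all add: l F_def N_def algebra_simps)
    ultimately show ?thesis
      by (simp add: divide_simps) (simp add: algebra_simps)
  qed
  finally show ?thesis
    by (simp add: J_def Q_int_eq)
qed

end

section \<open>Quasi-invariants\<close>

text \<open>Divisibility among all polynomials suffices: \<open>subalg_cancel\<close> puts the
  cofactor into \<open>polys n\<close>.\<close>

lemma quasi_invariants_iff: "P \<in> quasi_invariants n m \<longleftrightarrow> P \<in> polys n \<and>
    (\<forall>a\<in>{1..n}. \<forall>b\<in>{1..n}. a \<noteq> b \<longrightarrow>
      (X a - X b) ^ (2 * m + 1) dvd P - perm_act (Transposition.transpose a b) P)"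
proof -
  have "(\<exists>H\<in>polys n. P - perm_act (Transposition.transpose a b) P = (X a - X b) ^ (2 * m + 1) * H)
      \<longleftrightarrow> (X a - X b) ^ (2 * m + 1) dvd P - perm_act (Transposition.transpose a b) P"
    if "P \<in> polys n" "a \<in> {1..n}" "b \<in> {1..n}" "a \<noteq> b" for a b
  proof
    assume "(X a - X b) ^ (2 * m + 1) dvd P - perm_act (Transposition.transpose a b) P"
    then obtain H where H: "P - perm_act (Transposition.transpose a b) P = (X a - X b) ^ (2 * m + 1) * H"
      by (auto elim: dvdE)
    have "P - perm_act (Transposition.transpose a b) P \<in> polys n"
      using that perm_act_in_polys[OF that(1) permutes_swap_id[OF that(2,3)]]
      by (auto simp: polys_eq_subalg intro: subalg_diff)
    moreover have "(X a - X b) ^ (2 * m + 1) \<in> polys n"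
      using that unfolding polys_eq_subalg by (intro subalg_power subalg_diff subalg.gen imageI)
    moreover have "(X a - X b) ^ (2 * m + 1) \<noteq> 0"
      using that by simp
    ultimately have "H \<in> polys n"
      unfolding polys_eq_subalg H by (metis subalg_cancel)
    then show "\<exists>H\<in>polys n. P - perm_act (Transposition.transpose a b) P = (X a - X b) ^ (2 * m + 1) * H"
      using H by blast
  qed auto
  then show ?thesis
    unfolding quasi_invariants_def by blast
qed

lemma quasi_invariants_polys: "P \<in> quasi_invariants n m \<Longrightarrow> P \<in> polys n"
  by (simp add: quasi_invariants_iff)

lemma Lam_quasi_invariants: "P \<in> Lam n \<Longrightarrow> P \<in> quasi_invariants n m"
  by (auto simp: quasi_invariants_iff Lam_polys Lam_fixed permutes_swap_id)

lemma quasi_invariants_add: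
  assumes "P \<in> quasi_invariants n m" "Q \<in> quasi_invariants n m"
  shows "P + Q \<in> quasi_invariants n m"
  unfolding quasi_invariants_iff
proof (intro conjI ballI impI)
  show "P + Q \<in> polys n"
    using assms by (auto simp: quasi_invariants_iff polys_eq_subalg intro: subalg.add)
  fix a b assume *: "a \<in> {1..n}" "b \<in> {1..n}" "a \<noteq> b"
  let ?s = "perm_act (Transposition.transpose a b)"
  have "P + Q - ?s (P + Q) = (P - ?s P) + (Q - ?s Q)" by simp
  moreover have "(X a - X b) ^ (2 * m + 1) dvd P - ?s P" "(X a - X b) ^ (2 * m + 1) dvd Q - ?s Q"
    using assms * by (simp_all add: quasi_invariants_iff)
  ultimately show "(X a - X b) ^ (2 * m + 1) dvd P + Q - ?s (P + Q)"
    by (metis dvd_add)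
qed

lemma quasi_invariants_mult:
  assumes "P \<in> quasi_invariants n m" "Q \<in> quasi_invariants n m"
  shows "P * Q \<in> quasi_invariants n m"
  unfolding quasi_invariants_iff
proof (intro conjI ballI impI)
  show "P * Q \<in> polys n"
    using assms by (auto simp: quasi_invariants_iff polys_eq_subalg intro: subalg.mult)
  fix a b assume *: "a \<in> {1..n}" "b \<in> {1..n}" "a \<noteq> b"
  let ?s = "perm_act (Transposition.transpose a b)"
  have "P * Q - ?s (P * Q) = (P - ?s P) * Q + ?s P * (Q - ?s Q)"
    by (simp add: algebra_simps)
  moreover have "(X a - X b) ^ (2 * m + 1) dvd P - ?s P" "(X a - X b) ^ (2 * m + 1) dvd Q - ?s Q"
    using assms * by (simp_all add: quasi_invariants_iff)
  ultimately show "(X a - X b) ^ (2 * m + 1) dvd P * Q - ?s (P * Q)"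
    by (metis dvd_add dvd_mult dvd_mult2)
qed

lemma quasi_invariants_Lam_mult:
  "c \<in> Lam n \<Longrightarrow> P \<in> quasi_invariants n m \<Longrightarrow> c * P \<in> quasi_invariants n m"
  by (rule quasi_invariants_mult[OF Lam_quasi_invariants])

lemma quasi_invariants_0: "0 \<in> quasi_invariants n m"
  by (intro Lam_quasi_invariants Lam_intros)

lemma quasi_invariants_uminus: "P \<in> quasi_invariants n m \<Longrightarrow> - P \<in> quasi_invariants n m"
  using quasi_invariants_Lam_mult[of "- 1" n P m] by (simp add: Lam_intros)

lemma quasi_invariants_sum:
  "(\<And>i. i \<in> S \<Longrightarrow> f i \<in> quasi_invariants n m) \<Longrightarrow> sum f S \<in> quasi_invariants n m"
  by (induction S rule: infinite_finite_induct)
    (auto intro: quasi_invariants_add quasi_invariants_0)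

text \<open>Conjugation by \<open>\<sigma>\<close> carries the transposition of \<open>a'\<close>
  and \<open>b'\<close> to that of their images, so the condition for one pair becomes the condition
  for the other.\<close>

lemma quasi_invariants_perm_act:
  assumes P: "P \<in> quasi_invariants n m" and \<sigma>: "\<sigma> permutes {1..n}"
  shows "perm_act \<sigma> P \<in> quasi_invariants n m"
  unfolding quasi_invariants_iff
proof (intro conjI ballI impI)
  show "perm_act \<sigma> P \<in> polys n"
    using assms quasi_invariants_polys perm_act_in_polys by blast
  fix a b assume *: "a \<in> {1..n}" "b \<in> {1..n}" "a \<noteq> b"
  have bij: "bij \<sigma>" using \<sigma> permutes_bij by blast
  obtain a' b' where ab: "a = \<sigma> a'" "b = \<sigma> b'" "a' \<in> {1..n}" "b' \<in> {1..n}"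
    using * permutes_image[OF \<sigma>] by (metis imageE)
  have "a' \<noteq> b'" using *(3) ab by auto
  then have "(X a' - X b') ^ (2 * m + 1) dvd P - perm_act (Transposition.transpose a' b') P"
    using P ab(3,4) by (auto simp: quasi_invariants_iff simp del: atLeastAtMost_iff)
  then obtain H where H: "P - perm_act (Transposition.transpose a' b') P = (X a' - X b') ^ (2 * m + 1) * H"
    by (auto elim: dvdE)
  have "Transposition.transpose a b \<circ> \<sigma> = \<sigma> \<circ> Transposition.transpose a' b'"
    unfolding ab using bij
    by (auto simp: fun_eq_iff Transposition.transpose_def bij_is_inj inj_eq)
  then have "perm_act \<sigma> P - perm_act (Transposition.transpose a b) (perm_act \<sigma> P)
      = perm_act \<sigma> (P - perm_act (Transposition.transpose a' b') P)"
    by (simp add: perm_act_comp)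
  also have "\<dots> = (X a - X b) ^ (2 * m + 1) * perm_act \<sigma> H"
    unfolding H by (simp add: ab)
  finally show "(X a - X b) ^ (2 * m + 1) dvd
      perm_act \<sigma> P - perm_act (Transposition.transpose a b) (perm_act \<sigma> P)"
    by (metis dvd_triv_left)
qed

lemma quasi_invariants_galg_act:
  "P \<in> quasi_invariants n m \<Longrightarrow> galg_act n u P \<in> quasi_invariants n m"
  unfolding galg_act_def
  by (intro quasi_invariants_sum quasi_invariants_Lam_mult quasi_invariants_perm_act Lam_intros) auto

section \<open>The integrals as quasi-invariants, and the image of \<open>gamma n T\<close>\<close>

context hook_tableau
begin

text \<open>By additivity, a transposition changes the integral by the difference of two integrals,
  one for the motion of each endpoint. Each of these is 0 or, up to sign, an integral between
  \<open>x_a\<close> and \<open>x_b\<close>, which has the required factor.\<close>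

lemma Q_int_quasi_invariant: "Q_int n j k m \<in> quasi_invariants n m"
  unfolding quasi_invariants_iff
proof (intro conjI ballI impI)
  have one_in: "1 \<in> {1..n}" using n by simp
  show "Q_int n j k m \<in> polys n"
    unfolding Q_int_eq by (intro poly_integral_in_polys Q_integrand_LamP one_in j_in)
  fix a b assume *: "a \<in> {1..n}" "b \<in> {1..n}" "a \<noteq> b"
  define J where "J a b = poly_integral (X a) (X b) ([:0, 1:] ^ k * rootp n ^ m)" for a b
  let ?tr = "Transposition.transpose a b"
  have "?tr permutes {1..n}"
    using * by (intro permutes_swap_id)
  then have "perm_act ?tr (J 1 j) = J (?tr 1) (?tr j)"
    using perm_act_poly_integral[OF Q_integrand_LamP] by (simp add: J_def)
  moreover have "J 1 j - J x y = J 1 x - J j y" for x y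
  proof -
    have "J x y = J 1 y - J 1 x" "J j y = J 1 y - J 1 j"
      unfolding J_def by (metis add_diff_cancel_left' poly_integral_trans)+
    then show ?thesis by simp
  qed
  ultimately have "J 1 j - perm_act ?tr (J 1 j) = J 1 (?tr 1) - J j (?tr j)"
    by simp
  moreover have dvd: "(X a - X b) ^ (2 * m + 1) dvd J i (?tr i)" for i
  proof -
    obtain Y where "J b a = (X a - X b) ^ (2 * m + 1) * Y"
      using poly_integral_rootp_expand[OF *(2,1) *(3)[symmetric], of "[:0, 1:] ^ k" m]
      unfolding J_def by blast
    moreover have "J a b = - J b a"
      unfolding J_def by (rule poly_integral_swap)
    ultimately have "(X a - X b) ^ (2 * m + 1) dvd J a b" "(X a - X b) ^ (2 * m + 1) dvd J b a"
      by (simp_all only: dvd_minus_iff dvd_triv_left)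
    moreover have "J i i = 0" by (simp add: J_def)
    ultimately show ?thesis
      by (cases "i = a"; cases "i = b") (simp_all add: dvd_0_right)
  qed
  ultimately show "(X a - X b) ^ (2 * m + 1) dvd Q_int n j k m - perm_act ?tr (Q_int n j k m)"
    unfolding Q_int_eq J_def[symmetric] by (simp only: dvd_diff)
qed

text \<open>The row sum of \<open>P\<close> is still quasi-invariant and is symmetric in the
  variables other than \<open>x_j\<close>, so \<open>integral_representation\<close> applies to it;
  its case \<open>i = 1\<close> is the difference produced by \<open>gamma n T\<close>.\<close>

lemma gamma_quasi_invariant:
  assumes "P \<in> quasi_invariants n m"
  shows "\<exists>c. (\<forall>k. c k \<in> Lam n) \<and> galg_act n (gamma n T) P = (\<Sum>k<n - 1. c k * Q_int n j k m)"
proof -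
  let ?V = "{1..n} - {j}"
  have perm: "\<sigma> permutes {1..n}" if "\<sigma> permutes ?V" for \<sigma>
    using that by (rule permutes_subset) auto
  have S_qi: "row_sum P \<in> quasi_invariants n m"
    using assms perm by (intro quasi_invariants_sum quasi_invariants_perm_act) auto
  have "symm_on ?V (row_sum P)"
    unfolding symm_on_def
  proof (intro allI impI)
    fix \<tau> assume \<tau>: "\<tau> permutes ?V"
    show "perm_act \<tau> (row_sum P) = row_sum P"
      unfolding perm_act_sum perm_act_comp
      by (rule setum_permutations_compose_left[OF \<tau>, symmetric])
  qed
  moreover have "(X j - X i) ^ (2 * m + 1) dvd
      row_sum P - perm_act (Transposition.transpose i j) (row_sum P)" if "i \<in> ?V" for i
    using S_qi j_in that unfolding quasi_invariants_iff
    by (subst Transposition.transpose_commute) auto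
  ultimately obtain C where C: "C \<in> LamP n" "degree C \<le> n - 2"
    "\<And>i. i \<in> {1..n} \<Longrightarrow> row_sum P - perm_act (Transposition.transpose i j) (row_sum P)
      = poly_integral (X i) (X j) (C * rootp n ^ m)"
    using integral_representation[OF n j_in quasi_invariants_polys[OF S_qi]] by blast
  have "C = (\<Sum>k<n - 1. monom (coeff C k) k)"
  proof (rule poly_eqI)
    fix i
    have "coeff C i = 0" if "\<not> i < n - 1"
      using that C(2) n by (intro coeff_eq_0) auto
    then show "coeff C i = coeff (\<Sum>k<n - 1. monom (coeff C k) k) i"
      by (auto simp: coeff_sum)
  qed
  then have "poly_integral (X 1) (X j) (C * rootp n ^ m) = (\<Sum>k<n - 1. coeff C k * Q_int n j k m)"
    unfolding sum_Q_int by simp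
  then have "galg_act n (gamma n T) P
      = (\<Sum>k<n - 1. (Const (of_nat (n - 1) / fact n) * coeff C k) * Q_int n j k m)"
    using C(3)[of 1] n by (simp add: galg_act_gamma sum_distrib_left mult.assoc)
  moreover have "\<forall>k. Const (of_nat (n - 1) / fact n) * coeff C k \<in> Lam n"
    using C(1) by (auto simp: LamP_def intro: Lam_intros)
  ultimately show ?thesis
    by (intro exI[of _ "\<lambda>k. Const (of_nat (n - 1) / fact n) * coeff C k"] conjI)
qed

end

section \<open>The quotient ring\<close>

lemma QI_simps [simp]:
  "carrier (QI n m) = quasi_invariants n m" "x \<otimes>\<^bsub>QI n m\<^esub> y = x * y"
  "x \<oplus>\<^bsub>QI n m\<^esub> y = x + y" "\<zero>\<^bsub>QI n m\<^esub> = 0" "\<one>\<^bsub>QI n m\<^esub> = 1"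
  by (simp_all add: QI_def)

lemma QI_cring: "cring (QI n m)"
proof (rule cringI)
  show "abelian_group (QI n m)"
  proof (rule abelian_groupI)
    fix x assume "x \<in> carrier (QI n m)"
    then have "- x \<in> carrier (QI n m)" "- x \<oplus>\<^bsub>QI n m\<^esub> x = \<zero>\<^bsub>QI n m\<^esub>"
      by (simp_all add: quasi_invariants_uminus)
    then show "\<exists>y\<in>carrier (QI n m). y \<oplus>\<^bsub>QI n m\<^esub> x = \<zero>\<^bsub>QI n m\<^esub>" by blast
  qed (simp_all add: quasi_invariants_add quasi_invariants_0 algebra_simps)
  show "comm_monoid (QI n m)"
    by (rule comm_monoidI)
      (simp_all add: quasi_invariants_mult Lam_quasi_invariants Lam_intros algebra_simps)
qed (simp add: algebra_simps)

text \<open>The explicit form of the ideal \<open>esym_ideal n m\<close>, to which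
  \<open>esym_ideal_eq\<close> identifies it. Having one coefficient per generator is what the
  independence proof needs.\<close>

definition esym_combs :: "nat \<Rightarrow> nat \<Rightarrow> qpoly set" where
  "esym_combs n m = {\<Sum>k\<in>{1..n}. elem_sym n k * h k | h. \<forall>k. h k \<in> quasi_invariants n m}"

lemma esym_combsI:
  "(\<And>k. h k \<in> quasi_invariants n m) \<Longrightarrow> (\<Sum>k\<in>{1..n}. elem_sym n k * h k) \<in> esym_combs n m"
  unfolding esym_combs_def by blast

lemma esym_combsE:
  assumes "p \<in> esym_combs n m"
  obtains h where "p = (\<Sum>k\<in>{1..n}. elem_sym n k * h k)" "\<And>k. h k \<in> quasi_invariants n m"
  using assms unfolding esym_combs_def by blast

lemma esym_combs_quasi_invariants: "p \<in> esym_combs n m \<Longrightarrow> p \<in> quasi_invariants n m"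
  by (auto elim!: esym_combsE intro!: quasi_invariants_sum quasi_invariants_Lam_mult elem_sym_in_Lam)

lemma esym_combs_add:
  assumes "p \<in> esym_combs n m" "q \<in> esym_combs n m"
  shows "p + q \<in> esym_combs n m"
proof -
  obtain g h where "p = (\<Sum>k\<in>{1..n}. elem_sym n k * g k)" "\<And>k. g k \<in> quasi_invariants n m"
    "q = (\<Sum>k\<in>{1..n}. elem_sym n k * h k)" "\<And>k. h k \<in> quasi_invariants n m"
    using assms by (auto elim!: esym_combsE)
  moreover from this have "p + q = (\<Sum>k\<in>{1..n}. elem_sym n k * (g k + h k))"
    by (simp add: sum.distrib algebra_simps)
  ultimately show ?thesis
    by (simp add: esym_combsI quasi_invariants_add)
qed

lemma esym_combs_mult:
  assumes "p \<in> esym_combs n m" "q \<in> quasi_invariants n m"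
  shows "q * p \<in> esym_combs n m"
proof -
  obtain g where "p = (\<Sum>k\<in>{1..n}. elem_sym n k * g k)" "\<And>k. g k \<in> quasi_invariants n m"
    using assms by (auto elim!: esym_combsE)
  moreover from this have "q * p = (\<Sum>k\<in>{1..n}. elem_sym n k * (q * g k))"
    by (simp add: sum_distrib_left algebra_simps)
  ultimately show ?thesis
    using assms(2) by (simp add: esym_combsI quasi_invariants_mult)
qed

lemma esym_combs_uminus: "p \<in> esym_combs n m \<Longrightarrow> - p \<in> esym_combs n m"
  using esym_combs_mult[of p n m "- 1"] by (simp add: Lam_quasi_invariants Lam_intros)

lemma esym_combs_0: "0 \<in> esym_combs n m"
  using esym_combsI[of "\<lambda>_. 0" n m] by (simp add: quasi_invariants_0)

lemma esym_combs_sum: "(\<And>i. i \<in> S \<Longrightarrow> f i \<in> esym_combs n m) \<Longrightarrow> sum f S \<in> esym_combs n m"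
  by (induction S rule: infinite_finite_induct) (auto intro: esym_combs_add esym_combs_0)

text \<open>Links the two ideals: symmetric coefficients that vanish modulo
  \<open>esym_span n\<close> also vanish in front of quasi-invariants in the quotient.\<close>

lemma esym_span_mult_combs:
  assumes "s \<in> esym_span n" "q \<in> quasi_invariants n m"
  shows "s * q \<in> esym_combs n m"
proof -
  obtain g where "s = (\<Sum>k\<in>{1..n}. elem_sym n k * g k)" "\<forall>k. g k \<in> Lam n"
    using assms(1) unfolding esym_span_def by blast
  moreover from this have "s * q = (\<Sum>k\<in>{1..n}. elem_sym n k * (g k * q))"
    by (simp add: sum_distrib_right mult.assoc)
  ultimately show ?thesis
    using assms(2) by (simp add: esym_combsI quasi_invariants_Lam_mult)
qed

lemma esym_combs_ideal: "ideal (esym_combs n m) (QI n m)"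
proof (rule idealI)
  interpret cring "QI n m" by (rule QI_cring)
  show "ring (QI n m)" by (rule ring_axioms)
  show "subgroup (esym_combs n m) (add_monoid (QI n m))"
  proof (rule add.subgroupI)
    show "esym_combs n m \<subseteq> carrier (QI n m)"
      using esym_combs_quasi_invariants by auto
    show "esym_combs n m \<noteq> {}"
      using esym_combs_0 by blast
    fix a assume a: "a \<in> esym_combs n m"
    have "\<ominus>\<^bsub>QI n m\<^esub> a = - a"
      by (rule minus_equality)
        (use a in \<open>simp_all add: esym_combs_quasi_invariants quasi_invariants_uminus\<close>)
    then show "\<ominus>\<^bsub>QI n m\<^esub> a \<in> esym_combs n m"
      using a esym_combs_uminus by simp
  qed (auto intro: esym_combs_add)
  fix a x assume "a \<in> esym_combs n m" "x \<in> carrier (QI n m)"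
  then show "x \<otimes>\<^bsub>QI n m\<^esub> a \<in> esym_combs n m" "a \<otimes>\<^bsub>QI n m\<^esub> x \<in> esym_combs n m"
    using esym_combs_mult[of a n m x] by (simp_all add: mult.commute)
qed

lemma esym_ideal_eq: "esym_ideal n m = esym_combs n m"
proof
  interpret cring "QI n m" by (rule QI_cring)
  have gens: "elem_sym n ` {1..n} \<subseteq> esym_combs n m"
  proof safe
    fix k assume k: "k \<in> {1..n}"
    have "elem_sym n k \<in> esym_span n"
      using k by (rule elem_sym_in_esym_span)
    then show "elem_sym n k \<in> esym_combs n m"
      using esym_span_mult_combs[of _ n 1 m] by (simp add: Lam_quasi_invariants Lam_intros)
  qed
  show "esym_ideal n m \<subseteq> esym_combs n m"
    unfolding esym_ideal_def by (rule genideal_minimal[OF esym_combs_ideal gens])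
  show "esym_combs n m \<subseteq> esym_ideal n m"
  proof
    fix p assume "p \<in> esym_combs n m"
    then obtain h where h: "p = (\<Sum>k\<in>{1..n}. elem_sym n k * h k)" "\<And>k. h k \<in> quasi_invariants n m"
      by (rule esym_combsE) blast
    have gens_sub: "elem_sym n ` {1..n} \<subseteq> carrier (QI n m)"
      by (auto intro: Lam_quasi_invariants elem_sym_in_Lam)
    interpret I: ideal "esym_ideal n m" "QI n m"
      unfolding esym_ideal_def by (rule genideal_ideal[OF gens_sub])
    have terms: "elem_sym n k * h k \<in> esym_ideal n m" if "k \<in> {1..n}" for k
    proof -
      have "elem_sym n k \<in> esym_ideal n m"
        using genideal_self[OF gens_sub] that unfolding esym_ideal_def by blast
      then show ?thesis
        using I.I_r_closed[of "elem_sym n k" "h k"] h(2) by simp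
    qed
    have sum: "sum f S \<in> esym_ideal n m" if "\<And>k. k \<in> S \<Longrightarrow> f k \<in> esym_ideal n m"
      for f :: "nat \<Rightarrow> qpoly" and S
      using that
    proof (induction S rule: infinite_finite_induct)
      case (insert x S)
      then show ?case
        using I.a_closed[of "f x" "sum f S"] by simp
    qed (use I.zero_closed in simp_all)
    show "p \<in> esym_ideal n m"
      unfolding h(1) by (rule sum[OF terms])
  qed
qed

section \<open>Cosets, the induced action and spans\<close>

lemma QI_class_eq: "QI_class n m P = {i + P | i. i \<in> esym_combs n m}"
  by (auto simp: QI_class_def a_r_coset_def' esym_ideal_eq)

lemma QI_class_eq_iff: "QI_class n m P = QI_class n m Q \<longleftrightarrow> P - Q \<in> esym_combs n m"
proof
  assume "QI_class n m P = QI_class n m Q"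
  moreover have "P \<in> QI_class n m P"
    unfolding QI_class_eq using esym_combs_0 by force
  ultimately show "P - Q \<in> esym_combs n m"
    unfolding QI_class_eq by auto
next
  assume *: "P - Q \<in> esym_combs n m"
  have "i + P \<in> QI_class n m Q" "i + Q \<in> QI_class n m P" if "i \<in> esym_combs n m" for i
  proof -
    have "i + P = (i + (P - Q)) + Q" "i + Q = (i + - (P - Q)) + P" by simp_all
    moreover have "i + (P - Q) \<in> esym_combs n m" "i + - (P - Q) \<in> esym_combs n m"
      using that * esym_combs_add esym_combs_uminus by blast+
    ultimately show "i + P \<in> QI_class n m Q" "i + Q \<in> QI_class n m P"
      unfolding QI_class_eq by blast+
  qed
  then show "QI_class n m P = QI_class n m Q"
    by (auto simp: QI_class_eq)
qed

lemma QI_quot_simps: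
  "carrier (QI_quot n m) = QI_class n m ` quasi_invariants n m"
  "\<zero>\<^bsub>QI_quot n m\<^esub> = QI_class n m 0"
  by (auto simp: QI_quot_def FactRing_def A_RCOSETS_def' QI_class_def[symmetric])
    (auto simp: QI_class_eq esym_ideal_eq)

lemma QI_class_add:
  assumes "P \<in> quasi_invariants n m" "Q \<in> quasi_invariants n m"
  shows "QI_class n m P \<oplus>\<^bsub>QI_quot n m\<^esub> QI_class n m Q = QI_class n m (P + Q)"
  unfolding QI_class_def QI_quot_def
  using ring_hom_add[OF ideal.rcos_ring_hom[OF esym_combs_ideal[of n m]], of P Q] assms
  by (simp add: esym_ideal_eq)

lemma QI_class_mult:
  assumes "P \<in> quasi_invariants n m" "Q \<in> quasi_invariants n m"
  shows "QI_class n m P \<otimes>\<^bsub>QI_quot n m\<^esub> QI_class n m Q = QI_class n m (P * Q)"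
  unfolding QI_class_def QI_quot_def
  using ring_hom_mult[OF ideal.rcos_ring_hom[OF esym_combs_ideal[of n m]], of P Q] assms
  by (simp add: esym_ideal_eq)

lemma QI_quot_ring: "ring (QI_quot n m)"
  unfolding QI_quot_def esym_ideal_eq by (rule ideal.quotient_is_ring[OF esym_combs_ideal])

lemma Const_quasi_invariant: "Const c \<in> quasi_invariants n m"
  by (intro Lam_quasi_invariants Lam_intros)

text \<open>The generators are symmetric and pass through the action, which only changes the
  quasi-invariant coefficients. Hence the class of the image does not depend on the
  representative.\<close>

lemma galg_act_esym_combs:
  assumes "p \<in> esym_combs n m" shows "galg_act n u p \<in> esym_combs n m"
proof -
  obtain h where h: "p = (\<Sum>k\<in>{1..n}. elem_sym n k * h k)" "\<And>k. h k \<in> quasi_invariants n m"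
    using assms by (rule esym_combsE) blast
  have "galg_act n u p = (\<Sum>k\<in>{1..n}. elem_sym n k * galg_act n u (h k))"
    unfolding h(1) galg_act_sum by (intro sum.cong refl galg_act_Lam elem_sym_in_Lam)
  then show ?thesis
    using h(2) by (simp add: esym_combsI quasi_invariants_galg_act)
qed

lemma quot_act_class: "quot_act n m u (QI_class n m P) = QI_class n m (galg_act n u P)"
proof -
  have "QI_class n m (galg_act n u (i + P)) = QI_class n m (galg_act n u P)"
    if "i \<in> esym_combs n m" for i
    unfolding QI_class_eq_iff using galg_act_esym_combs[OF that] by (simp add: galg_act_add)
  then have "\<forall>R\<in>QI_class n m P. QI_class n m (galg_act n u R) = QI_class n m (galg_act n u P)"
    unfolding QI_class_eq[of n m P] by auto
  moreover have "QI_class n m P \<noteq> {}"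
    unfolding QI_class_eq using esym_combs_0 by blast
  ultimately show ?thesis
    unfolding quot_act_def by auto
qed

text \<open>The list is indexed by distinct keys so that the scalars can be given as a function of
  the key.\<close>

lemma Span_QI_class:
  assumes "distinct ks" "\<And>k. k \<in> set ks \<Longrightarrow> q k \<in> quasi_invariants n m"
  shows "ring.Span (QI_quot n m) (scalars n m) (map (\<lambda>k. QI_class n m (q k)) ks)
    = {QI_class n m (\<Sum>k\<in>set ks. Const (c k) * q k) | c. True}"
  using assms
proof (induction ks)
  case Nil
  show ?case
    by (simp add: ring.Span.simps[OF QI_quot_ring] QI_quot_simps)
next
  case (Cons l ks)
  interpret R: ring "QI_quot n m" by (rule QI_quot_ring)
  let ?cl = "QI_class n m" and ?S = "\<lambda>c. \<Sum>k\<in>set ks. Const (c k) * q k"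
  have ql: "q l \<in> quasi_invariants n m" using Cons.prems by simp
  have S_qi: "?S c \<in> quasi_invariants n m" for c
    using Cons.prems by (intro quasi_invariants_sum quasi_invariants_mult Const_quasi_invariant) auto
  have comb: "(?cl (Const d) \<otimes>\<^bsub>QI_quot n m\<^esub> ?cl (q l)) \<oplus>\<^bsub>QI_quot n m\<^esub> ?cl (?S c)
      = ?cl (Const d * q l + ?S c)" for c d
    using ql S_qi
    by (simp add: QI_class_mult QI_class_add Const_quasi_invariant quasi_invariants_mult)
  have "R.Span (scalars n m) (map (\<lambda>k. ?cl (q k)) (l # ks))
      = R.line_extension (scalars n m) (?cl (q l)) {?cl (?S c) | c. True}"
    using Cons by simp
  also have "\<dots> = {(?cl (Const d) \<otimes>\<^bsub>QI_quot n m\<^esub> ?cl (q l)) \<oplus>\<^bsub>QI_quot n m\<^esub> ?cl (?S c) | c d. True}"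
    unfolding R.line_extension_def set_add_def' r_coset_def scalars_def by blast
  also have "\<dots> = {?cl (Const d * q l + ?S c) | c d. True}"
    by (simp only: comb)
  also have "\<dots> = {?cl (\<Sum>k\<in>set (l # ks). Const (c k) * q k) | c. True}"
  proof (intro equalityI subsetI)
    have split: "(\<Sum>k\<in>set (l # ks). Const (c k) * q k) = Const (c l) * q l + ?S c" for c
      using Cons.prems(1) by simp
    {
      fix C assume "C \<in> {?cl (Const d * q l + ?S c) | c d. True}"
      then obtain c d where C: "C = ?cl (Const d * q l + ?S c)" by blast
      \<comment> \<open>The key \<open>l\<close> is not in \<open>ks\<close>, so its scalar can be
        chosen freely.\<close>
      have "?S (c(l := d)) = ?S c"
        using Cons.prems(1) by (intro sum.cong) auto
      then have "C = ?cl (\<Sum>k\<in>set (l # ks). Const ((c(l := d)) k) * q k)"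
        unfolding split C by simp
      then show "C \<in> {?cl (\<Sum>k\<in>set (l # ks). Const (c k) * q k) | c. True}" by blast
    next
      fix C assume "C \<in> {?cl (\<Sum>k\<in>set (l # ks). Const (c k) * q k) | c. True}"
      then show "C \<in> {?cl (Const d * q l + ?S c) | c d. True}"
        unfolding split by blast
    }
  qed
  finally show ?case .
qed

section \<open>The basis of the image in the quotient\<close>

context hook_tableau
begin

text \<open>Applying \<open>gamma n T\<close> fixes the left side of a relation and turns the
  arbitrary coefficients \<open>h i\<close> into \<open>\<Lambda>\<close>-combinations of the
  integrals. Independence over \<open>\<Lambda>\<close> then equates each \<open>c k\<close> with a
  combination of elementary symmetric polynomials, which has no constant term.\<close>

lemma Q_int_independent_mod:
  assumes "(\<Sum>k<n - 1. Const (c k) * Q_int n j k m) \<in> esym_combs n m" "k < n - 1"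
  shows "c k = 0"
proof -
  let ?Q = "\<lambda>k. Q_int n j k m" and ?G = "galg_act n (gamma n T)"
  obtain h where h: "(\<Sum>k<n - 1. Const (c k) * ?Q k) = (\<Sum>i\<in>{1..n}. elem_sym n i * h i)"
    "\<And>i. h i \<in> quasi_invariants n m"
    using assms(1) by (rule esym_combsE) blast
  obtain d where d: "\<And>i k. d i k \<in> Lam n" "\<And>i. ?G (h i) = (\<Sum>k<n - 1. d i k * ?Q k)"
    using gamma_quasi_invariant[OF h(2)] by metis
  have "(\<Sum>k<n - 1. Const (c k) * ?Q k) = ?G (\<Sum>k<n - 1. Const (c k) * ?Q k)"
    unfolding galg_act_sum by (intro sum.cong refl) (simp add: galg_act_Lam Lam_intros gamma_Q_int)
  also have "\<dots> = (\<Sum>i\<in>{1..n}. elem_sym n i * (\<Sum>k<n - 1. d i k * ?Q k))"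
    unfolding h(1) galg_act_sum d(2)[symmetric] by (intro sum.cong refl galg_act_Lam elem_sym_in_Lam)
  also have "\<dots> = (\<Sum>k<n - 1. (\<Sum>i\<in>{1..n}. elem_sym n i * d i k) * ?Q k)"
    unfolding sum_distrib_left sum_distrib_right
    by (subst sum.swap) (simp add: mult.assoc)
  finally have "(\<Sum>k<n - 1. (Const (c k) - (\<Sum>i\<in>{1..n}. elem_sym n i * d i k)) * ?Q k) = 0"
    by (simp add: left_diff_distrib sum_subtractf)
  then have "Const (c k) - (\<Sum>i\<in>{1..n}. elem_sym n i * d i k) = 0"
    using assms(2)
    by (intro Q_int_independent[where c = "\<lambda>k. Const (c k) - (\<Sum>i\<in>{1..n}. elem_sym n i * d i k)"])
      (auto intro!: Lam_intros Lam_sum elem_sym_in_Lam d(1))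
  \<comment> \<open>Evaluation at 0 reads off constant terms; it kills each elementary symmetric
    polynomial of positive degree.\<close>
  then have "subst (\<lambda>_. 0) (Const (c k)) = subst (\<lambda>_. 0) (\<Sum>i\<in>{1..n}. elem_sym n i * d i k)"
    by simp
  also have "\<dots> = 0"
  proof -
    have "subst (\<lambda>_. 0) (elem_sym n i) = 0" if "i \<in> {1..n}" for i
      unfolding elem_sym_def subst_sum subst_prod
      using that by (intro sum.neutral) (auto simp: card_gt_0_iff)
    then show ?thesis by (simp add: subst_sum)
  qed
  finally show ?thesis by simp
qed

text \<open>Independence of a list means that each entry lies outside the span of its successors, so
  the claim is made for any distinct list of indices and proved by peeling off the head.\<close>

lemma Q_int_classes_independent:
  assumes "distinct ks" "set ks \<subseteq> {..<n - 1}"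
  shows "ring.independent (QI_quot n m) (scalars n m) (map (\<lambda>k. QI_class n m (Q_int n j k m)) ks)"
  using assms
proof (induction ks)
  case Nil
  show ?case
    using ring.li_Nil[OF QI_quot_ring] by simp
next
  case (Cons l ks)
  interpret R: ring "QI_quot n m" by (rule QI_quot_ring)
  have "QI_class n m (Q_int n j l m) \<notin>
      R.Span (scalars n m) (map (\<lambda>k. QI_class n m (Q_int n j k m)) ks)"
  proof
    assume "QI_class n m (Q_int n j l m) \<in>
      R.Span (scalars n m) (map (\<lambda>k. QI_class n m (Q_int n j k m)) ks)"
    then obtain c where "QI_class n m (Q_int n j l m)
        = QI_class n m (\<Sum>k\<in>set ks. Const (c k) * Q_int n j k m)"
      using Span_QI_class[of ks "\<lambda>k. Q_int n j k m" n m] Cons.prems Q_int_quasi_invariant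
      by auto
    then have mem: "Q_int n j l m - (\<Sum>k\<in>set ks. Const (c k) * Q_int n j k m) \<in> esym_combs n m"
      by (simp add: QI_class_eq_iff)
    \<comment> \<open>Moving the span to the other side gives a relation whose coefficient at
      \<open>l\<close> is 1; padding with 0 makes it a relation among all \<open>n - 1\<close>
      integrals.\<close>
    define c' where "c' k = (if k = l then 1 else if k \<in> set ks then - c k else 0)" for k
    have "(\<Sum>k<n - 1. Const (c' k) * Q_int n j k m)
        = (\<Sum>k\<in>insert l (set ks). Const (c' k) * Q_int n j k m)"
      using Cons.prems by (intro sum.mono_neutral_right) (auto simp: c'_def)
    also have "\<dots> = Q_int n j l m + (\<Sum>k\<in>set ks. Const (c' k) * Q_int n j k m)"
      using Cons.prems by (simp add: c'_def)
    also have "(\<Sum>k\<in>set ks. Const (c' k) * Q_int n j k m)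
        = - (\<Sum>k\<in>set ks. Const (c k) * Q_int n j k m)"
      unfolding sum_negf[symmetric] using Cons.prems
      by (intro sum.cong) (auto simp: c'_def Const_minus)
    finally have "c' l = 0"
      using mem Cons.prems by (intro Q_int_independent_mod[of c' m]) auto
    then show False by (simp add: c'_def)
  qed
  moreover have "QI_class n m (Q_int n j l m) \<in> carrier (QI_quot n m)"
    by (simp add: QI_quot_simps Q_int_quasi_invariant)
  ultimately show ?case
    using Cons by (simp add: R.li_Cons del: R.Span.simps)
qed

text \<open>The image is a \<open>\<Lambda>\<close>-combination of the integrals, and
  \<open>Lam_decompose\<close> makes the coefficients constant modulo the ideal. Conversely, each
  rational combination is its own image by \<open>gamma_Q_int\<close>.\<close>

lemma gamma_image_class:
  "quot_act n m (gamma n T) ` carrier (QI_quot n m)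
    = {QI_class n m (\<Sum>k<n - 1. Const (c k) * Q_int n j k m) | c. True}"
proof safe
  fix C assume "C \<in> carrier (QI_quot n m)"
  then obtain P where P: "C = QI_class n m P" "P \<in> quasi_invariants n m"
    by (auto simp: QI_quot_simps)
  obtain c where c: "\<And>k. c k \<in> Lam n"
    "galg_act n (gamma n T) P = (\<Sum>k<n - 1. c k * Q_int n j k m)"
    using gamma_quasi_invariant[OF P(2)] by blast
  obtain d where d: "\<And>k. c k - Const (d k) \<in> esym_span n"
    using Lam_decompose[OF c(1)] by metis
  have "(\<Sum>k<n - 1. c k * Q_int n j k m) - (\<Sum>k<n - 1. Const (d k) * Q_int n j k m)
      = (\<Sum>k<n - 1. (c k - Const (d k)) * Q_int n j k m)"
    by (simp add: left_diff_distrib sum_subtractf)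
  also have "\<dots> \<in> esym_combs n m"
    by (intro esym_combs_sum esym_span_mult_combs d Q_int_quasi_invariant)
  finally have "quot_act n m (gamma n T) C = QI_class n m (\<Sum>k<n - 1. Const (d k) * Q_int n j k m)"
    by (simp add: P(1) quot_act_class QI_class_eq_iff c(2))
  then show "\<exists>c. quot_act n m (gamma n T) C
      = QI_class n m (\<Sum>k<n - 1. Const (c k) * Q_int n j k m) \<and> True" by blast
next
  fix c :: "nat \<Rightarrow> rat"
  let ?P = "\<Sum>k<n - 1. Const (c k) * Q_int n j k m"
  have "?P \<in> quasi_invariants n m"
    by (intro quasi_invariants_sum quasi_invariants_mult Const_quasi_invariant Q_int_quasi_invariant)
  moreover have "galg_act n (gamma n T) ?P = ?P"
    unfolding galg_act_sum by (intro sum.cong refl) (simp add: galg_act_Lam Lam_intros gamma_Q_int)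
  ultimately show "QI_class n m ?P \<in> quot_act n m (gamma n T) ` carrier (QI_quot n m)"
    unfolding QI_quot_simps by (metis (no_types, lifting) imageI quot_act_class)
qed

end

theorem theorem5p6:
  fixes n m j :: nat and T :: "nat \<times> nat \<Rightarrow> nat"
  assumes "n \<ge> 2"
    and "standard_tableau [n - 1, 1] T"
    and "j = T (1, 0)"
  shows "is_basis (QI_quot n m) (scalars n m)
    (map (\<lambda>k. QI_class n m (Q_int n j k m)) [0..<n - 1])
    (quot_act n m (gamma n T) ` carrier (QI_quot n m))"
proof -
  interpret hook_tableau n T j
    using assms by unfold_locales
  have "set [0..<n - 1] = {..<n - 1}" by auto
  then show ?thesis
    unfolding is_basis_def gamma_image_class
    using Q_int_classes_independent[of "[0..<n - 1]" m]
      Span_QI_class[of "[0..<n - 1]" "\<lambda>k. Q_int n j k m" n m] Q_int_quasi_invariant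
    by (simp del: set_upt)
qed

end
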